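(* Let $M\ge 1$ be an integer, let $\varphi(s)=\sum_{n=0}^{M}\alpha_n s^n$, $s\in\mathbb{R}$, with $\alpha_0,\dots,\alpha_M\in\mathbb{R}$ and $\alpha_M\ne 0$, and let $\mathbb{A}=\mathbb{B}=\mathbb{R}_+=[0,+\infty)$, $c(a,b)=\varphi(a-b)$ for $a,b\in\mathbb{R}_+$. (a) If $M$ is odd and $\alpha_M>0$, then $\{\mathbb{A},\mathbb{B},c\}$ is a two-person zero-sum game (conditions (iv) and (v) of the context hold) and: for each $b$ the function $a\mapsto c(a,b)$ is lower semi-continuous, and for some $b_0$ the function $a\mapsto c(a,b_0)$ is inf-compact on $\mathbb{A}$; for each $a$ the function $b\mapsto c(a,b)$ is upper semi-continuous, and for some $a_0$ the function $b\mapsto c(a_0,b)$ is sup-compact on $\mathbb{B}$; $\hat c^{\sharp}(\pi^{\mathbb A})>v^{\sharp}$ for all $\pi^{\mathbb A}\in\mathbb{P}^U(\mathbb{A})$; and $\hat c^{\flat}(\pi^{\mathbb B})<v^{\flat}$ for all $\pi^{\mathbb B}\in\mathbb{P}^U(\mathbb{B})$. Therefore the game has a value $v\in\mathbb{R}$ and a solution $(\pi^{\mathbb A},\pi^{\mathbb B})\in\mathbb{P}^{\sharp}_v(\mathbb{A})\times\mathbb{P}^{\flat}_v(\mathbb{B})$; the sets $\mathbb{P}^{\sharp}_v(\mathbb{A})$ and $\mathbb{P}^{\flat}_v(\mathbb{B})$ are nonempty convex compact subsets of $\mathbb{P}(\mathbb{A})$ and $\mathbb{P}(\mathbb{B})$,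 contained in $\mathbb{P}^S(\mathbb{A})$ and $\mathbb{P}^S(\mathbb{B})$ respectively; and a pair $(\pi^{\mathbb A},\pi^{\mathbb B})\in\mathbb{P}^S(\mathbb{A})\times\mathbb{P}^S(\mathbb{B})$ is a solution if and only if $\pi^{\mathbb A}\in\mathbb{P}^{\sharp}_v(\mathbb{A})$ and $\pi^{\mathbb B}\in\mathbb{P}^{\flat}_v(\mathbb{B})$. Furthermore, if in addition $M\ge 3$ and $\alpha_1<0$, then there is no pure solution for this game. (b) If $M$ is even or $\alpha_M<0$, then at least one of the conditions (iv), (v) of the context fails, and there is no finite value because $|v^{\flat}|=+\infty$ or $|v^{\sharp}|=+\infty$.
   Context: For a metric space $S$, $\mathbb{P}(S)$ is the set of Borel probability measures on $S$ with the topology of weak convergence. A function $f:S\to\mathbb{R}\cup\{\pm\infty\}$ is inf-compact on $S$ if $\{s\in S: f(s)\le\lambda\}$ is compact for every $\lambda\in\mathbb{R}$, and sup-compact if $-f$ is inf-compact. Let $\mathbb{A},\mathbb{B}$ be nonempty Borel subsets of Polish spaces and $c:\mathbb{A}\times\mathbb{B}\to\mathbb{R}$ Borel measurable (the payoff from Player I to Player II). The triplet $\{\mathbb{A},\mathbb{B},c\}$ is a two-person zero-sum game if also (iv) for each $b\in\mathbb{B}$ the function $a\mapsto c(a,b)$ is bounded below on $\mathbb{A}$, and (v) for each $a\in\mathbb{A}$ the function $b\mapsto c(a,b)$ is bounded above on $\mathbb{B}$. Strategies of Players I and II are elements of $\mathbb{P}(\mathbb{A})$ and $\mathbb{P}(\mathbb{B})$;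 a point $a$ (or $b$) is identified with the Dirac measure at it, and Dirac measures are called pure strategies. Let $c^+=\max\{c,0\}$, $c^-=\min\{c,0\}$ (so $c^-\le 0$), $\hat c^{\oplus}(\pi^{\mathbb A},\pi^{\mathbb B})=\int_{\mathbb A}\int_{\mathbb B}c^+(a,b)\,\pi^{\mathbb B}(db)\,\pi^{\mathbb A}(da)$ and $\hat c^{\ominus}(\pi^{\mathbb A},\pi^{\mathbb B})=\int_{\mathbb A}\int_{\mathbb B}c^-(a,b)\,\pi^{\mathbb B}(db)\,\pi^{\mathbb A}(da)$. The expected payoff $\hat c(\pi^{\mathbb A},\pi^{\mathbb B})=\hat c^{\oplus}(\pi^{\mathbb A},\pi^{\mathbb B})+\hat c^{\ominus}(\pi^{\mathbb A},\pi^{\mathbb B})$ is well-defined if $\hat c^{\oplus}(\pi^{\mathbb A},\pi^{\mathbb B})<+\infty$ or $\hat c^{\ominus}(\pi^{\mathbb A},\pi^{\mathbb B})>-\infty$, and undefined otherwise. $\mathbb{P}^S(\mathbb{A})$ (sensible strategies) is the set of $\pi^{\mathbb A}\in\mathbb{P}(\mathbb{A})$ such that $\hat c(\pi^{\mathbb A},\pi^{\mathbb B})$ is well-defined for every $\pi^{\mathbb B}\in\mathbb{P}(\mathbb{B})$, and $\mathbb{P}^U(\mathbb{A})=\mathbb{P}(\mathbb{A})\setminus\mathbb{P}^S(\mathbb{A})$; $\mathbb{P}^S(\mathbb{B})$ and $\mathbb{P}^U(\mathbb{B})$ are defined symmetrically. $\hat c^{\flat}(\pi^{\mathbb B})=\inf_{a\in\mathbb{A}}\hat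 c(a,\pi^{\mathbb B})$ and $\hat c^{\sharp}(\pi^{\mathbb A})=\sup_{b\in\mathbb{B}}\hat c(\pi^{\mathbb A},b)$ (these are meaningful for all strategies if (iv),(v) hold, and for sensible strategies in any case); $v^{\flat}=\sup_{\pi^{\mathbb B}\in\mathbb{P}^S(\mathbb{B})}\hat c^{\flat}(\pi^{\mathbb B})$, $v^{\sharp}=\inf_{\pi^{\mathbb A}\in\mathbb{P}^S(\mathbb{A})}\hat c^{\sharp}(\pi^{\mathbb A})$. There is a value $v$ if $v^{\flat}=v^{\sharp}$, and then $v$ is this common quantity. $\mathbb{P}^{\sharp}_{\alpha}(\mathbb{A})=\{\pi^{\mathbb A}\in\mathbb{P}(\mathbb{A}):\hat c^{\sharp}(\pi^{\mathbb A})\le\alpha\}$ and $\mathbb{P}^{\flat}_{\alpha}(\mathbb{B})=\{\pi^{\mathbb B}\in\mathbb{P}(\mathbb{B}):\hat c^{\flat}(\pi^{\mathbb B})\ge\alpha\}$. A solution is a pair $(\pi^{\mathbb A},\pi^{\mathbb B})\in\mathbb{P}^S(\mathbb{A})\times\mathbb{P}^S(\mathbb{B})$ with $\hat c(\pi^{\mathbb A},\pi^{\mathbb B}_* )\le\hat c(\pi^{\mathbb A},\pi^{\mathbb B})\le\hat c(\pi^{\mathbb A}_*,\pi^{\mathbb B})$ for all $\pi^{\mathbb A}_*\in\mathbb{P}(\mathbb{A})$, $\pi^{\mathbb B}_*\in\mathbb{P}(\mathbb{B})$; it is pure if both strategies are pure. *)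

theory Defs
  imports "HOL-Probability.Probability"
begin

section \<open>Borel probability measures on a subset and weak convergence\<close>

text \<open>A Borel subset of a Polish space is given as a set \<open>S\<close> in a type of class
  \<^class>\<open>polish_space\<close>. Its probability measures live on the trace sigma-algebra, so their
  underlying space is \<open>S\<close> itself and not the whole type.\<close>

definition borel_on :: "'a::topological_space set \<Rightarrow> 'a measure" where
  "borel_on S = restrict_space borel S"

definition borel_probs :: "'a::topological_space set \<Rightarrow> 'a measure set" where
  "borel_probs S = space (prob_algebra (borel_on S))"

definition dirac :: "'a::topological_space set \<Rightarrow> 'a \<Rightarrow> 'a measure" where
  "dirac S x = return (borel_on S) x"

text \<open>The coarsest topology on \<^term>\<open>borel_probs S\<close> for which integration against each bounded
  continuous real function on \<open>S\<close> is continuous.\<close>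

definition weak_topology :: "'a::topological_space set \<Rightarrow> 'a measure topology" where
  "weak_topology S = topology_generated_by
     {{\<mu> \<in> borel_probs S. (\<integral>x. f x \<partial>\<mu>) \<in> U} | f U.
        continuous_on S f \<and> bounded (f ` S) \<and> open (U :: real set)}"

text \<open>The type of measures is not a vector space, so convexity is stated through setwise
  mixtures.\<close>

definition mixture :: "real \<Rightarrow> 'a measure \<Rightarrow> 'a measure \<Rightarrow> 'a measure" where
  "mixture t \<mu> \<nu> = measure_of (space \<mu>) (sets \<mu>)
     (\<lambda>E. ennreal t * emeasure \<mu> E + ennreal (1 - t) * emeasure \<nu> E)"

definition convex_measures :: "'a measure set \<Rightarrow> bool" where
  "convex_measures K \<longleftrightarrow> (\<forall>\<mu>\<in>K. \<forall>\<nu>\<in>K. \<forall>t\<in>{0..1}. mixture t \<mu> \<nu> \<in> K)"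


section \<open>Semicontinuity and inf-compactness\<close>

text \<open>At an isolated point of \<open>S\<close> the filter is trivial and the limit inferior is \<open>\<infinity>\<close>, so the
  condition is vacuous there, as it should be.\<close>

definition lsc_on :: "'a::topological_space set \<Rightarrow> ('a \<Rightarrow> ereal) \<Rightarrow> bool" where
  "lsc_on S f \<longleftrightarrow> (\<forall>x\<in>S. f x \<le> Liminf (at x within S) f)"

definition usc_on :: "'a::topological_space set \<Rightarrow> ('a \<Rightarrow> ereal) \<Rightarrow> bool" where
  "usc_on S f \<longleftrightarrow> lsc_on S (\<lambda>x. - f x)"

definition inf_compact_on :: "'a::topological_space set \<Rightarrow> ('a \<Rightarrow> ereal) \<Rightarrow> bool" where
  "inf_compact_on S f \<longleftrightarrow> (\<forall>l::real. compact {s\<in>S. f s \<le> ereal l})"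

definition sup_compact_on :: "'a::topological_space set \<Rightarrow> ('a \<Rightarrow> ereal) \<Rightarrow> bool" where
  "sup_compact_on S f \<longleftrightarrow> inf_compact_on S (\<lambda>s. - f s)"


section \<open>Two-person zero-sum games with possibly unbounded payoffs\<close>

definition bounded_below_I :: "'a set \<Rightarrow> 'b set \<Rightarrow> ('a \<Rightarrow> 'b \<Rightarrow> real) \<Rightarrow> bool" where
  "bounded_below_I A B c \<longleftrightarrow> (\<forall>b\<in>B. bdd_below ((\<lambda>a. c a b) ` A))"

definition bounded_above_II :: "'a set \<Rightarrow> 'b set \<Rightarrow> ('a \<Rightarrow> 'b \<Rightarrow> real) \<Rightarrow> bool" where
  "bounded_above_II A B c \<longleftrightarrow> (\<forall>a\<in>A. bdd_above ((\<lambda>b. c a b) ` B))"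

definition zero_sum_game ::
  "'a::polish_space set \<Rightarrow> 'b::polish_space set \<Rightarrow> ('a \<Rightarrow> 'b \<Rightarrow> real) \<Rightarrow> bool" where
  "zero_sum_game A B c \<longleftrightarrow>
     A \<noteq> {} \<and> A \<in> sets borel \<and> B \<noteq> {} \<and> B \<in> sets borel \<and>
     (\<lambda>(a, b). c a b) \<in> borel_measurable (borel_on (A \<times> B)) \<and>
     bounded_below_I A B c \<and> bounded_above_II A B c"

definition payoff_pos ::
  "('a \<Rightarrow> 'b \<Rightarrow> real) \<Rightarrow> 'a measure \<Rightarrow> 'b measure \<Rightarrow> ereal" where
  "payoff_pos c p q = enn2ereal (\<integral>\<^sup>+ a. (\<integral>\<^sup>+ b. ennreal (max (c a b) 0) \<partial>q) \<partial>p)"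

text \<open>The negative part \<open>min (c a b) 0\<close> is nonpositive; its integral is minus the nonnegative
  integral of its absolute value.\<close>

definition payoff_neg ::
  "('a \<Rightarrow> 'b \<Rightarrow> real) \<Rightarrow> 'a measure \<Rightarrow> 'b measure \<Rightarrow> ereal" where
  "payoff_neg c p q = - enn2ereal (\<integral>\<^sup>+ a. (\<integral>\<^sup>+ b. ennreal (- min (c a b) 0) \<partial>q) \<partial>p)"

definition payoff_defined ::
  "('a \<Rightarrow> 'b \<Rightarrow> real) \<Rightarrow> 'a measure \<Rightarrow> 'b measure \<Rightarrow> bool" where
  "payoff_defined c p q \<longleftrightarrow> payoff_pos c p q < \<infinity> \<or> payoff_neg c p q > - \<infinity>"

text \<open>Meaningful only under \<^const>\<open>payoff_defined\<close>; otherwise the sum is \<open>\<infinity> + - \<infinity>\<close>, which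
  the library sets to \<open>\<infinity>\<close>.\<close>

definition payoff ::
  "('a \<Rightarrow> 'b \<Rightarrow> real) \<Rightarrow> 'a measure \<Rightarrow> 'b measure \<Rightarrow> ereal" where
  "payoff c p q = payoff_pos c p q + payoff_neg c p q"

definition sensible_I ::
  "'a::polish_space set \<Rightarrow> 'b::polish_space set \<Rightarrow> ('a \<Rightarrow> 'b \<Rightarrow> real) \<Rightarrow> 'a measure set" where
  "sensible_I A B c = {p \<in> borel_probs A. \<forall>q\<in>borel_probs B. payoff_defined c p q}"

definition sensible_II ::
  "'a::polish_space set \<Rightarrow> 'b::polish_space set \<Rightarrow> ('a \<Rightarrow> 'b \<Rightarrow> real) \<Rightarrow> 'b measure set" where
  "sensible_II A B c = {q \<in> borel_probs B. \<forall>p\<in>borel_probs A. payoff_defined c p q}"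

definition payoff_flat ::
  "'a::polish_space set \<Rightarrow> ('a \<Rightarrow> 'b \<Rightarrow> real) \<Rightarrow> 'b measure \<Rightarrow> ereal" where
  "payoff_flat A c q = (INF a\<in>A. payoff c (dirac A a) q)"

definition payoff_sharp ::
  "'b::polish_space set \<Rightarrow> ('a \<Rightarrow> 'b \<Rightarrow> real) \<Rightarrow> 'a measure \<Rightarrow> ereal" where
  "payoff_sharp B c p = (SUP b\<in>B. payoff c p (dirac B b))"

definition v_flat ::
  "'a::polish_space set \<Rightarrow> 'b::polish_space set \<Rightarrow> ('a \<Rightarrow> 'b \<Rightarrow> real) \<Rightarrow> ereal" where
  "v_flat A B c = (SUP q\<in>sensible_II A B c. payoff_flat A c q)"

definition v_sharp ::
  "'a::polish_space set \<Rightarrow> 'b::polish_space set \<Rightarrow> ('a \<Rightarrow> 'b \<Rightarrow> real) \<Rightarrow> ereal" where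
  "v_sharp A B c = (INF p\<in>sensible_I A B c. payoff_sharp B c p)"

definition is_game_value ::
  "'a::polish_space set \<Rightarrow> 'b::polish_space set \<Rightarrow> ('a \<Rightarrow> 'b \<Rightarrow> real) \<Rightarrow> ereal \<Rightarrow> bool" where
  "is_game_value A B c v \<longleftrightarrow> v_flat A B c = v \<and> v_sharp A B c = v"

definition P_sharp ::
  "'a::polish_space set \<Rightarrow> 'b::polish_space set \<Rightarrow> ('a \<Rightarrow> 'b \<Rightarrow> real) \<Rightarrow> ereal \<Rightarrow> 'a measure set" where
  "P_sharp A B c l = {p \<in> borel_probs A. payoff_sharp B c p \<le> l}"

definition P_flat ::
  "'a::polish_space set \<Rightarrow> 'b::polish_space set \<Rightarrow> ('a \<Rightarrow> 'b \<Rightarrow> real) \<Rightarrow> ereal \<Rightarrow> 'b measure set" where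
  "P_flat A B c l = {q \<in> borel_probs B. payoff_flat A c q \<ge> l}"

definition is_solution ::
  "'a::polish_space set \<Rightarrow> 'b::polish_space set \<Rightarrow> ('a \<Rightarrow> 'b \<Rightarrow> real) \<Rightarrow>
   'a measure \<Rightarrow> 'b measure \<Rightarrow> bool" where
  "is_solution A B c p q \<longleftrightarrow>
     p \<in> sensible_I A B c \<and> q \<in> sensible_II A B c \<and>
     (\<forall>p'\<in>borel_probs A. \<forall>q'\<in>borel_probs B.
        payoff c p q' \<le> payoff c p q \<and> payoff c p q \<le> payoff c p' q)"

definition is_pure_solution ::
  "'a::polish_space set \<Rightarrow> 'b::polish_space set \<Rightarrow> ('a \<Rightarrow> 'b \<Rightarrow> real) \<Rightarrow>
   'a measure \<Rightarrow> 'b measure \<Rightarrow> bool" where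
  "is_pure_solution A B c p q \<longleftrightarrow>
     is_solution A B c p q \<and> p \<in> dirac A ` A \<and> q \<in> dirac B ` B"

end

theory Submission
  imports Defs
begin

text \<open>Everything rests on the growth of \<open>\<phi>\<close>. When the degree \<open>m\<close> is odd and the leading
coefficient is positive, \<open>\<phi> s\<close> lies between two positive multiples of \<open>s ^ m\<close>, up to constants,
for \<open>s \<ge> 0\<close>, and so does \<open>- \<phi> (- s)\<close>. This pair of bounds is preserved when the players
are exchanged, that is, when \<open>\<phi>\<close> is replaced by \<open>\<lambda>s. - \<phi> (- s)\<close>; so every fact about
Player I yields the corresponding fact about Player II. The locale \<open>odd_growth\<close> records the bounds
together with the continuity of \<open>\<phi>\<close>, and the existence results hold for every such function.

The bounds give a coercivity estimate: \<open>a ^ m\<close> is at most an affine function of \<open>\<phi> (a - b)\<close>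
with coefficients depending on \<open>b\<close> only. Hence a strategy of Player I whose payoff against one pure
strategy is finite has a finite moment of order \<open>m\<close>; conversely a finite moment of that order makes the
strategy sensible. A strategy that is not sensible therefore has \<open>payoff_sharp = \<infinity>\<close>, which
exceeds the value. Coercivity also makes the sublevel sets of \<open>payoff_sharp\<close> tight, and lower
semicontinuity of the payoff under weak limits makes them sequentially compact. This gives an optimal
strategy of Player I for the level \<open>v_sharp\<close> and compactness of the set of all of them.

The remaining point is that Player II can secure \<open>v_sharp\<close>. For finitely many actions \<open>a\<close> and
a number \<open>w < v_sharp\<close>, Player II replies to every mixture of these actions with some \<open>b\<close> that
earns more than \<open>w\<close>, since a mixture is a sensible strategy of Player I. Blackwell's regret argument
(lemma \<open>approachability\<close>) turns these replies into one sequence whose empirical distribution earns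
at least \<open>w\<close> against each of the finitely many actions at once. A weak limit along an exhaustion of a
countable dense set of actions, with \<open>w\<close> tending to \<open>v_sharp\<close>, is a strategy that earns
\<open>v_sharp\<close> against all actions. So \<open>v_flat = v_sharp\<close>, and solutions are the pairs of
optimal strategies.

A pure saddle point \<open>(a, b)\<close> forces \<open>\<phi>\<close> to be constant on \<open>{- b..a}\<close>, so
\<open>a = b = 0\<close>, and then \<open>0\<close> minimizes \<open>\<phi>\<close> on the half-line, which a negative
derivative at \<open>0\<close> excludes.

If the leading coefficient is negative, \<open>\<phi>\<close> tends to \<open>- \<infinity>\<close> at \<open>\<infinity>\<close>. Against a
sensible strategy of Player II the gains are bounded uniformly in \<open>a\<close>, while by Fatou's lemma the
losses tend to infinity with \<open>a\<close>; hence \<open>v_flat = - \<infinity>\<close>. The case of an even degree with positive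
leading coefficient is the same statement with the players exchanged.\<close>

section \<open>Payoffs of mixed strategies\<close>

text \<open>Since \<^term>\<open>ennreal\<close> truncates negative reals to \<open>0\<close>, this is the integral of the positive
part of the payoff; the negative part is the gain for the payoff \<open>\<lambda>a b. - c a b\<close>. Working with two
extended nonnegative integrals keeps \<open>\<infinity> - \<infinity>\<close> out of the calculations.\<close>

definition gain :: "('a \<Rightarrow> 'b \<Rightarrow> real) \<Rightarrow> 'a measure \<Rightarrow> 'b measure \<Rightarrow> ennreal" where
  "gain c p q = (\<integral>\<^sup>+ a. (\<integral>\<^sup>+ b. ennreal (c a b) \<partial>q) \<partial>p)"

lemma ennreal_max_0: "ennreal (max x 0) = ennreal x"
  by (cases "x \<ge> 0") (auto simp: ennreal_neg max_def)

lemma ennreal_minus_min_0: "ennreal (- min x 0) = ennreal (- x)"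
  by (cases "x \<le> 0") (auto simp: ennreal_neg min_def)

lemma payoff_eq_gain: "payoff c p q = enn2ereal (gain c p q) - enn2ereal (gain (\<lambda>a b. - c a b) p q)"
  unfolding payoff_def payoff_pos_def payoff_neg_def gain_def ennreal_max_0 ennreal_minus_min_0
  by (simp add: minus_ereal_def)

lemma payoff_defined_iff_gain:
  "payoff_defined c p q \<longleftrightarrow> gain c p q \<noteq> \<infinity> \<or> gain (\<lambda>a b. - c a b) p q \<noteq> \<infinity>"
proof -
  have "enn2ereal x < \<infinity> \<longleftrightarrow> x \<noteq> \<infinity>" for x
    by (cases x) auto
  moreover have "- enn2ereal x > - \<infinity> \<longleftrightarrow> x \<noteq> \<infinity>" for x
    by (cases x) auto
  ultimately show ?thesis
    unfolding payoff_defined_def payoff_pos_def payoff_neg_def gain_def ennreal_max_0 ennreal_minus_min_0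
    by simp
qed

text \<open>Splitting \<open>v\<close> into its positive and negative part turns a bound on the payoff into an inequality
between nonnegative quantities, which can be integrated over the other player's strategy. The two lemmas
are not mirror images, because \<open>\<infinity> - \<infinity>\<close> equals \<open>\<infinity>\<close> for \<^typ>\<open>ereal\<close>: an
undefined payoff counts as large.\<close>

lemma payoff_le_iff_gain:
  "payoff c p q \<le> ereal v \<longleftrightarrow>
     gain c p q \<noteq> \<infinity> \<and> gain c p q + ennreal (- v) \<le> gain (\<lambda>a b. - c a b) p q + ennreal v"
proof -
  have "enn2ereal x - enn2ereal y \<le> ereal v \<longleftrightarrow> x \<noteq> \<infinity> \<and> x + ennreal (- v) \<le> y + ennreal v" for x y
    by (cases x; cases y; cases "v \<ge> 0") (auto simp: ennreal_neg enn2ereal_ennreal top_unique simp flip: ennreal_plus)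
  then show ?thesis
    unfolding payoff_eq_gain .
qed

lemma payoff_ge_iff_gain:
  "payoff c p q \<ge> ereal v \<longleftrightarrow>
     gain (\<lambda>a b. - c a b) p q + ennreal v \<le> gain c p q + ennreal (- v)"
proof -
  have "enn2ereal x - enn2ereal y \<ge> ereal v \<longleftrightarrow> y + ennreal v \<le> x + ennreal (- v)" for x y
    by (cases x; cases y; cases "v \<ge> 0") (auto simp: ennreal_neg enn2ereal_ennreal top_unique simp flip: ennreal_plus)
  then show ?thesis
    unfolding payoff_eq_gain .
qed

lemma borel_probsD:
  assumes "p \<in> borel_probs S"
  shows "prob_space p" "sets p = sets (borel_on S)" "space p = S"
  using assms sets_eq_imp_space_eq[of p "borel_on S"]
  by (auto simp: borel_probs_def space_prob_algebra borel_on_def space_restrict_space)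

lemma dirac_in_borel_probs: "x \<in> S \<Longrightarrow> dirac S x \<in> borel_probs S"
  by (auto simp: borel_probs_def space_prob_algebra dirac_def borel_on_def space_restrict_space
      intro!: prob_space_return)

lemma space_borel_on [simp]: "space (borel_on S) = S"
  by (simp add: borel_on_def space_restrict_space)

text \<open>Measurability with respect to the product sigma-algebra is what Tonelli's theorem needs in order to
exchange the roles of the players.\<close>

locale measurable_game =
  fixes A :: "'a::polish_space set" and B :: "'b::polish_space set" and c :: "'a \<Rightarrow> 'b \<Rightarrow> real"
  assumes measurable_payoff: "(\<lambda>(a, b). c a b) \<in> borel_measurable (borel_on A \<Otimes>\<^sub>M borel_on B)"
begin

lemma measurable_reversed: "(\<lambda>(b, a). - c a b) \<in> borel_measurable (borel_on B \<Otimes>\<^sub>M borel_on A)"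
  using measurable_pair_swap[OF measurable_payoff] by (simp add: case_prod_beta')

lemma measurable_opposite: "(\<lambda>(a, b). - c a b) \<in> borel_measurable (borel_on A \<Otimes>\<^sub>M borel_on B)"
  using measurable_payoff by (simp add: case_prod_beta')

lemma measurable_payoff_I:
  assumes "b \<in> B"
  shows "(\<lambda>a. c a b) \<in> borel_measurable (borel_on A)"
  using measurable_compose[OF measurable_Pair2' measurable_payoff, of b] assms by simp

lemma measurable_payoff_II:
  assumes "a \<in> A"
  shows "(\<lambda>b. c a b) \<in> borel_measurable (borel_on B)"
  using measurable_compose[OF measurable_Pair1' measurable_payoff, of a] assms by simp

lemma measurable_inner_gain:
  assumes q: "q \<in> borel_probs B"
  shows "(\<lambda>a. \<integral>\<^sup>+ b. ennreal (c a b) \<partial>q) \<in> borel_measurable (borel_on A)"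
proof -
  interpret prob_space q by (rule borel_probsD[OF q])
  have "(\<lambda>(a, b). c a b) \<in> borel_measurable (borel_on A \<Otimes>\<^sub>M q)"
    using measurable_payoff borel_probsD(2)[OF q] by (simp cong: measurable_cong_sets sets_pair_measure_cong)
  then have "(\<lambda>x. ennreal (case x of (a, b) \<Rightarrow> c a b)) \<in> borel_measurable (borel_on A \<Otimes>\<^sub>M q)"
    by simp
  from borel_measurable_nn_integral_fst[OF this] show ?thesis by simp
qed

lemma gain_swap:
  assumes p: "p \<in> borel_probs A" and q: "q \<in> borel_probs B"
  shows "gain (\<lambda>b a. c a b) q p = gain c p q"
proof -
  interpret p: prob_space p by (rule borel_probsD[OF p])
  interpret q: prob_space q by (rule borel_probsD[OF q])
  interpret pair_sigma_finite p q ..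
  have "(\<lambda>(a, b). c a b) \<in> borel_measurable (p \<Otimes>\<^sub>M q)"
    using measurable_payoff borel_probsD(2)[OF p] borel_probsD(2)[OF q]
    by (simp cong: measurable_cong_sets sets_pair_measure_cong)
  then have "(\<lambda>x. ennreal (case x of (a, b) \<Rightarrow> c a b)) \<in> borel_measurable (p \<Otimes>\<^sub>M q)"
    by simp
  from Fubini[OF this] show ?thesis by (simp add: gain_def)
qed

lemma gain_dirac_I:
  assumes "a \<in> A" "q \<in> borel_probs B"
  shows "gain c (dirac A a) q = (\<integral>\<^sup>+ b. ennreal (c a b) \<partial>q)"
  unfolding gain_def dirac_def using assms measurable_inner_gain
  by (subst nn_integral_return) auto

lemma gain_dirac_II:
  assumes "b \<in> B" "p \<in> borel_probs A"
  shows "gain c p (dirac B b) = (\<integral>\<^sup>+ a. ennreal (c a b) \<partial>p)"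
  unfolding gain_def dirac_def using assms measurable_payoff_II borel_probsD(3)[OF assms(2)]
  by (intro nn_integral_cong, subst nn_integral_return) auto


lemma measurable_game_opposite: "measurable_game A B (\<lambda>a b. - c a b)"
  by unfold_locales (rule measurable_opposite)

lemma measurable_game_reversed: "measurable_game B A (\<lambda>b a. - c a b)"
  by unfold_locales (rule measurable_reversed)

lemma payoff_dirac_II:
  assumes "p \<in> borel_probs A" "b \<in> B" "integrable p (\<lambda>a. c a b)"
  shows "payoff c p (dirac B b) = ereal (\<integral>a. c a b \<partial>p)"
proof -
  have "enn2ereal x - enn2ereal y = ereal (enn2real x - enn2real y)" if "x \<noteq> \<infinity>" "y \<noteq> \<infinity>" for x y
    using that by (cases x; cases y) auto
  then show ?thesis
    using assms measurable_game.gain_dirac_II[OF measurable_game_opposite]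
    by (simp add: payoff_eq_gain gain_dirac_II real_lebesgue_integral_def real_integrable_def)
qed

lemma payoff_dirac_I:
  assumes "q \<in> borel_probs B" "a \<in> A" "integrable q (\<lambda>b. c a b)"
  shows "payoff c (dirac A a) q = ereal (\<integral>b. c a b \<partial>q)"
proof -
  have "enn2ereal x - enn2ereal y = ereal (enn2real x - enn2real y)" if "x \<noteq> \<infinity>" "y \<noteq> \<infinity>" for x y
    using that by (cases x; cases y) auto
  then show ?thesis
    using assms measurable_game.gain_dirac_I[OF measurable_game_opposite]
    by (simp add: payoff_eq_gain gain_dirac_I real_lebesgue_integral_def real_integrable_def)
qed

text \<open>A bound against all pure strategies of Player II extends to mixed ones by integrating the inequality of
\<open>payoff_le_iff_gain\<close>. The payoff has to be defined: a mixed strategy can make both parts infinite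
although every pure one gives a finite payoff.\<close>

lemma payoff_le_of_dirac:
  assumes p: "p \<in> borel_probs A" and q: "q \<in> borel_probs B"
    and defd: "payoff_defined c p q"
    and le: "\<And>b. b \<in> B \<Longrightarrow> payoff c p (dirac B b) \<le> ereal v"
  shows "payoff c p q \<le> ereal v"
proof -
  interpret opp: measurable_game A B "\<lambda>a b. - c a b" by (rule measurable_game_opposite)
  interpret rev: measurable_game B A "\<lambda>b a. - c a b" by (rule measurable_game_reversed)
  interpret rev': measurable_game B A "\<lambda>b a. - (- c a b)" by (rule opp.measurable_game_reversed)
  interpret q: prob_space q by (rule borel_probsD[OF q])
  have sets: "sets q = sets (borel_on B)" by (rule borel_probsD[OF q])
  have inner: "(\<integral>\<^sup>+ a. ennreal (c a b) \<partial>p) + ennreal (- v) \<le> (\<integral>\<^sup>+ a. ennreal (- c a b) \<partial>p) + ennreal v"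
    if "b \<in> B" for b
    using le[OF that] gain_dirac_II[OF that p] opp.gain_dirac_II[OF that p]
    by (simp add: payoff_le_iff_gain)
  have meas: "(\<lambda>b. \<integral>\<^sup>+ a. ennreal (c a b) \<partial>p) \<in> borel_measurable q"
             "(\<lambda>b. \<integral>\<^sup>+ a. ennreal (- c a b) \<partial>p) \<in> borel_measurable q"
    using rev.measurable_inner_gain[OF p] rev'.measurable_inner_gain[OF p]
    by (simp_all cong: measurable_cong_sets add: sets)
  have "(\<integral>\<^sup>+ b. (\<integral>\<^sup>+ a. ennreal (c a b) \<partial>p) + ennreal (- v) \<partial>q)
      \<le> (\<integral>\<^sup>+ b. (\<integral>\<^sup>+ a. ennreal (- c a b) \<partial>p) + ennreal v \<partial>q)"
    by (rule nn_integral_mono) (use inner borel_probsD(3)[OF q] in auto)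
  then have "gain (\<lambda>b a. c a b) q p + ennreal (- v) \<le> gain (\<lambda>b a. - c a b) q p + ennreal v"
    using meas by (simp add: nn_integral_add gain_def q.emeasure_space_1)
  then have main: "gain c p q + ennreal (- v) \<le> gain (\<lambda>a b. - c a b) p q + ennreal v"
    using gain_swap[OF p q] opp.gain_swap[OF p q] by simp
  moreover have "gain c p q \<noteq> \<infinity>"
  proof
    assume "gain c p q = \<infinity>"
    with main have "gain (\<lambda>a b. - c a b) p q = \<infinity>"
      by (cases "gain (\<lambda>a b. - c a b) p q") (auto simp: top_unique simp flip: ennreal_plus)
    with \<open>gain c p q = \<infinity>\<close> defd show False
      by (simp add: payoff_defined_iff_gain)
  qed
  ultimately show ?thesis by (simp add: payoff_le_iff_gain)
qed

lemma payoff_ge_of_dirac: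
  assumes p: "p \<in> borel_probs A" and q: "q \<in> borel_probs B"
    and ge: "\<And>a. a \<in> A \<Longrightarrow> payoff c (dirac A a) q \<ge> ereal v"
  shows "payoff c p q \<ge> ereal v"
proof -
  interpret opp: measurable_game A B "\<lambda>a b. - c a b" by (rule measurable_game_opposite)
  interpret p: prob_space p by (rule borel_probsD[OF p])
  have sets: "sets p = sets (borel_on A)" by (rule borel_probsD[OF p])
  have inner: "(\<integral>\<^sup>+ b. ennreal (- c a b) \<partial>q) + ennreal v \<le> (\<integral>\<^sup>+ b. ennreal (c a b) \<partial>q) + ennreal (- v)"
    if "a \<in> A" for a
    using ge[OF that] gain_dirac_I[OF that q] opp.gain_dirac_I[OF that q]
    by (simp add: payoff_ge_iff_gain)
  have meas: "(\<lambda>a. \<integral>\<^sup>+ b. ennreal (c a b) \<partial>q) \<in> borel_measurable p"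
             "(\<lambda>a. \<integral>\<^sup>+ b. ennreal (- c a b) \<partial>q) \<in> borel_measurable p"
    using measurable_inner_gain[OF q] opp.measurable_inner_gain[OF q]
    by (simp_all cong: measurable_cong_sets add: sets)
  have "(\<integral>\<^sup>+ a. (\<integral>\<^sup>+ b. ennreal (- c a b) \<partial>q) + ennreal v \<partial>p)
      \<le> (\<integral>\<^sup>+ a. (\<integral>\<^sup>+ b. ennreal (c a b) \<partial>q) + ennreal (- v) \<partial>p)"
    by (rule nn_integral_mono) (use inner borel_probsD(3)[OF p] in auto)
  then have "gain (\<lambda>a b. - c a b) p q + ennreal v \<le> gain c p q + ennreal (- v)"
    using meas by (simp add: nn_integral_add gain_def p.emeasure_space_1)
  then show ?thesis by (simp add: payoff_ge_iff_gain)
qed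

lemma payoff_defined_reversed:
  assumes "p \<in> borel_probs A" "q \<in> borel_probs B"
  shows "payoff_defined (\<lambda>b a. - c a b) q p \<longleftrightarrow> payoff_defined c p q"
  using gain_swap[OF assms] measurable_game.gain_swap[OF measurable_game_opposite assms]
  by (auto simp: payoff_defined_iff_gain)

text \<open>Exchanging the players changes the sign of the payoff, but only where it is defined: an undefined payoff
is \<open>\<infinity>\<close> for both orders of the players.\<close>

lemma payoff_reversed:
  assumes "p \<in> borel_probs A" "q \<in> borel_probs B" "payoff_defined c p q"
  shows "payoff (\<lambda>b a. - c a b) q p = - payoff c p q"
  using assms(3) gain_swap[OF assms(1,2)]
    measurable_game.gain_swap[OF measurable_game_opposite assms(1,2)]
  by (cases "gain c p q"; cases "gain (\<lambda>a b. - c a b) p q")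
     (auto simp: payoff_eq_gain payoff_defined_iff_gain)

lemma sensible_I_reversed: "sensible_I B A (\<lambda>b a. - c a b) = sensible_II A B c"
  by (auto simp: sensible_I_def sensible_II_def payoff_defined_reversed)

lemma payoff_sharp_reversed:
  assumes "q \<in> borel_probs B" "\<And>a. a \<in> A \<Longrightarrow> payoff_defined c (dirac A a) q"
  shows "payoff_sharp A (\<lambda>b a. - c a b) q = - payoff_flat A c q"
proof -
  have "payoff_sharp A (\<lambda>b a. - c a b) q = (SUP a\<in>A. - payoff c (dirac A a) q)"
    unfolding payoff_sharp_def
    by (intro SUP_cong refl payoff_reversed dirac_in_borel_probs assms)
  then show ?thesis
    by (simp add: payoff_flat_def ereal_SUP_uminus_eq)
qed

lemma v_sharp_reversed: "v_sharp B A (\<lambda>b a. - c a b) = - v_flat A B c"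
proof -
  have "v_sharp B A (\<lambda>b a. - c a b) = (INF q\<in>sensible_II A B c. - payoff_flat A c q)"
    unfolding v_sharp_def sensible_I_reversed
    by (intro INF_cong refl payoff_sharp_reversed)
       (auto simp: sensible_II_def dirac_in_borel_probs)
  then show ?thesis
    by (simp add: v_flat_def ereal_INF_uminus_eq)
qed

lemma P_sharp_reversed:
  assumes "\<And>a q. a \<in> A \<Longrightarrow> q \<in> borel_probs B \<Longrightarrow> payoff_defined c (dirac A a) q"
  shows "P_sharp B A (\<lambda>b a. - c a b) (- v) = P_flat A B c v"
  by (auto simp: P_sharp_def P_flat_def payoff_sharp_reversed assms)

text \<open>If the game has a value, the inequalities \<open>v \<le> payoff_sharp p \<le> payoff p q \<le> payoff_flat q \<le> v\<close>
that a solution satisfies are all equalities, and optimality on both sides gives the saddle inequalities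
back through the pure strategies.\<close>

lemma solution_iff_optimal:
  assumes v: "v_flat A B c = ereal v" "v_sharp A B c = ereal v"
    and p: "p \<in> sensible_I A B c" and q: "q \<in> sensible_II A B c"
  shows "is_solution A B c p q \<longleftrightarrow> p \<in> P_sharp A B c (ereal v) \<and> q \<in> P_flat A B c (ereal v)"
proof
  have pq: "p \<in> borel_probs A" "q \<in> borel_probs B"
    using p q by (auto simp: sensible_I_def sensible_II_def)
  {
    assume sol: "is_solution A B c p q"
    have "payoff_sharp B c p \<le> payoff c p q"
      unfolding payoff_sharp_def
      by (rule SUP_least) (use sol pq dirac_in_borel_probs[of _ B] in \<open>auto simp: is_solution_def\<close>)
    moreover have "payoff c p q \<le> payoff_flat A c q"
      unfolding payoff_flat_def
      by (rule INF_greatest) (use sol pq dirac_in_borel_probs[of _ A] in \<open>auto simp: is_solution_def\<close>)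
    moreover have "ereal v \<le> payoff_sharp B c p"
      unfolding v(2)[symmetric] v_sharp_def by (rule INF_lower) (rule p)
    moreover have "payoff_flat A c q \<le> ereal v"
      unfolding v(1)[symmetric] v_flat_def by (rule SUP_upper) (rule q)
    ultimately show "p \<in> P_sharp A B c (ereal v) \<and> q \<in> P_flat A B c (ereal v)"
      using pq by (auto simp: P_sharp_def P_flat_def)
  next
    assume opt: "p \<in> P_sharp A B c (ereal v) \<and> q \<in> P_flat A B c (ereal v)"
    have le: "payoff c p q' \<le> ereal v" if "q' \<in> borel_probs B" for q'
    proof (rule payoff_le_of_dirac[OF pq(1) that])
      show "payoff_defined c p q'" using p that by (auto simp: sensible_I_def)
      show "payoff c p (dirac B b) \<le> ereal v" if "b \<in> B" for b
        using opt that by (auto simp: P_sharp_def payoff_sharp_def SUP_le_iff)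
    qed
    have ge: "payoff c p' q \<ge> ereal v" if "p' \<in> borel_probs A" for p'
    proof (rule payoff_ge_of_dirac[OF that pq(2)])
      show "payoff c (dirac A a) q \<ge> ereal v" if "a \<in> A" for a
        using opt that by (auto simp: P_flat_def payoff_flat_def le_INF_iff)
    qed
    show "is_solution A B c p q"
      unfolding is_solution_def using p q le ge pq by (meson order_trans)
  }
qed

end


section \<open>Mixtures\<close>

text \<open>Drawing one of the two measures with a coin is the monadic bind, so countable additivity and the
integration formula of mixtures come from the Giry monad.\<close>

lemma mixture_eq_bind:
  assumes p: "p \<in> borel_probs S" and p': "p' \<in> borel_probs S" and t: "t \<in> {0..1}"
  shows "mixture t p p' = measure_pmf (bernoulli_pmf t) \<bind> (\<lambda>x. if x then p else p')" (is "_ = ?bind")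
    and "mixture t p p' \<in> borel_probs S"
proof -
  have K: "(\<lambda>x. if x then p else p') \<in> measure_pmf (bernoulli_pmf t) \<rightarrow>\<^sub>M prob_algebra (borel_on S)"
    using p p' by (auto simp: borel_probs_def)
  have K': "(\<lambda>x. if x then p else p') \<in> measure_pmf (bernoulli_pmf t) \<rightarrow>\<^sub>M subprob_algebra (borel_on S)"
    using K by (rule measurable_prob_algebraD)
  have B: "measure_pmf (bernoulli_pmf t) \<in> space (prob_algebra (measure_pmf (bernoulli_pmf t)))"
    by (simp add: space_prob_algebra measure_pmf.prob_space_axioms)
  have sets: "sets ?bind = sets (borel_on S)" by (rule sets_bind'[OF B K])
  then have space: "space ?bind = S" using sets_eq_imp_space_eq[OF sets] by simp
  have em: "emeasure ?bind E = ennreal t * emeasure p E + ennreal (1 - t) * emeasure p' E"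
    if "E \<in> sets (borel_on S)" for E
    using t by (subst emeasure_bind[OF _ K' that]) (auto simp: mult.commute)
  have "mixture t p p' = measure_of S (sets (borel_on S)) (emeasure ?bind)"
    unfolding mixture_def borel_probsD(3)[OF p] borel_probsD(2)[OF p]
    by (rule measure_of_eq)
       (use sets.space_closed[of "borel_on S"] sets.sigma_sets_eq[of "borel_on S"] in \<open>auto simp: em\<close>)
  also have "\<dots> = ?bind"
    using measure_of_of_measure[of ?bind] by (simp add: sets space)
  finally show eq: "mixture t p p' = ?bind" .
  show "mixture t p p' \<in> borel_probs S"
    unfolding eq borel_probs_def space_prob_algebra using sets prob_space_bind'[OF B K] by simp
qed

lemma nn_integral_mixture:
  assumes p: "p \<in> borel_probs S" and p': "p' \<in> borel_probs S" and t: "t \<in> {0..1}"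
    and f: "f \<in> borel_measurable (borel_on S)"
  shows "(\<integral>\<^sup>+ x. f x \<partial>mixture t p p') = ennreal t * (\<integral>\<^sup>+ x. f x \<partial>p) + ennreal (1 - t) * (\<integral>\<^sup>+ x. f x \<partial>p')"
proof -
  have "(\<lambda>x. if x then p else p') \<in> measure_pmf (bernoulli_pmf t) \<rightarrow>\<^sub>M prob_algebra (borel_on S)"
    using p p' by (auto simp: borel_probs_def)
  then have "(\<lambda>x. if x then p else p') \<in> measure_pmf (bernoulli_pmf t) \<rightarrow>\<^sub>M subprob_algebra (borel_on S)"
    by (rule measurable_prob_algebraD)
  then show ?thesis
    unfolding mixture_eq_bind(1)[OF p p' t] using t
    by (subst nn_integral_bind[OF f]) (auto simp: mult.commute)
qed

text \<open>The condition of \<open>payoff_le_iff_gain\<close> is an inequality between functions that are affine in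
Player I's strategy.\<close>

lemma (in measurable_game) convex_measures_P_sharp: "convex_measures (P_sharp A B c (ereal v))"
  unfolding convex_measures_def
proof (intro ballI)
  interpret opp: measurable_game A B "\<lambda>a b. - c a b" by (rule measurable_game_opposite)
  fix p p' and t :: real
  assume pp': "p \<in> P_sharp A B c (ereal v)" "p' \<in> P_sharp A B c (ereal v)" and t: "t \<in> {0..1}"
  have P: "p \<in> borel_probs A" "p' \<in> borel_probs A" using pp' by (auto simp: P_sharp_def)
  let ?m = "mixture t p p'"
  have m: "?m \<in> borel_probs A" by (rule mixture_eq_bind(2)[OF P t])
  have "payoff c ?m (dirac B b) \<le> ereal v" if b: "b \<in> B" for b
  proof -
    have le: "payoff c p (dirac B b) \<le> ereal v" "payoff c p' (dirac B b) \<le> ereal v"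
      using pp' b by (auto simp: P_sharp_def payoff_sharp_def SUP_le_iff)
    have lin: "gain f ?m (dirac B b) = ennreal t * gain f p (dirac B b) + ennreal (1 - t) * gain f p' (dirac B b)"
      if "measurable_game A B f" for f
    proof -
      have "(\<lambda>a. ennreal (f a b)) \<in> borel_measurable (borel_on A)"
        using measurable_game.measurable_payoff_I[OF that b] by simp
      from nn_integral_mixture[OF P t this] show ?thesis
        by (simp add: measurable_game.gain_dirac_II[OF that b] P m)
    qed
    note lins = lin[OF measurable_game_axioms] lin[OF measurable_game_opposite]
    have split: "ennreal t * r + ennreal (1 - t) * r = r" for r
      using t by (simp flip: distrib_right ennreal_plus)
    have "gain c ?m (dirac B b) + ennreal (- v)
        = ennreal t * (gain c p (dirac B b) + ennreal (- v)) + ennreal (1 - t) * (gain c p' (dirac B b) + ennreal (- v))"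
      unfolding lins by (subst split[of "ennreal (- v)", symmetric]) (simp add: algebra_simps)
    also have "\<dots> \<le> ennreal t * (gain (\<lambda>a b. - c a b) p (dirac B b) + ennreal v)
        + ennreal (1 - t) * (gain (\<lambda>a b. - c a b) p' (dirac B b) + ennreal v)"
      using le by (intro add_mono[OF mult_left_mono mult_left_mono]) (auto simp: payoff_le_iff_gain)
    also have "\<dots> = gain (\<lambda>a b. - c a b) ?m (dirac B b) + ennreal v"
      unfolding lins by (subst (3) split[of "ennreal v", symmetric]) (simp add: algebra_simps)
    finally show ?thesis
      using le by (auto simp: payoff_le_iff_gain lins ennreal_mult_eq_top_iff)
  qed
  then show "?m \<in> P_sharp A B c (ereal v)"
    using m by (auto simp: P_sharp_def payoff_sharp_def SUP_le_iff)
qed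

section \<open>Weak convergence on a closed subset of the line\<close>

text \<open>Weak convergence, tightness and characteristic functions are developed for measures on the Borel sets of
the whole line, so a measure that lives on a subset is first pushed forward along the inclusion.\<close>

definition on_line :: "real measure \<Rightarrow> real measure" where
  "on_line p = distr p borel (\<lambda>x. x)"

lemma measurable_borel_on: "f \<in> borel_measurable borel \<Longrightarrow> f \<in> borel_measurable (borel_on S)"
  unfolding borel_on_def by (rule measurable_restrict_space1)

lemma measurable_borel_probs:
  "p \<in> borel_probs S \<Longrightarrow> f \<in> borel_measurable (borel_on S) \<Longrightarrow> f \<in> borel_measurable p"
  using borel_probsD(2)[of p S] by (simp cong: measurable_cong_sets)

lemma borel_measurable_borel_probs:
  "p \<in> borel_probs S \<Longrightarrow> f \<in> borel_measurable borel \<Longrightarrow> f \<in> borel_measurable p"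
  by (rule measurable_borel_probs[OF _ measurable_borel_on])

lemma real_distribution_on_line: "p \<in> borel_probs S \<Longrightarrow> real_distribution (on_line p)"
  unfolding on_line_def
  by (rule prob_space.real_distribution_distr[OF borel_probsD(1)])
     (auto intro: borel_measurable_borel_probs)

lemma integral_on_line:
  fixes f :: "real \<Rightarrow> 'b::{banach, second_countable_topology}"
  assumes "p \<in> borel_probs S" "f \<in> borel_measurable borel"
  shows "(\<integral>x. f x \<partial>on_line p) = (\<integral>x. f x \<partial>p)"
  unfolding on_line_def 
  by (rule integral_distr[OF _ assms(2)])
     (rule borel_measurable_borel_probs[OF assms(1) measurable_ident_sets[OF refl]])

lemma on_line_restrict_space:
  assumes M: "real_distribution M" and S: "S \<in> sets borel" and AE: "AE x in M. x \<in> S"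
  shows "restrict_space M S \<in> borel_probs S" "on_line (restrict_space M S) = M"
proof -
  interpret M: real_distribution M by (rule M)
  have sets: "sets (restrict_space M S) = sets (borel_on S)"
    unfolding borel_on_def by (rule sets_restrict_space_cong) simp
  have S': "S \<inter> space M \<in> sets M" using S by simp
  have "emeasure M S = 1"
    using AE S by (intro M.emeasure_eq_1_AE) auto
  then show R: "restrict_space M S \<in> borel_probs S"
    by (auto simp: borel_probs_def space_prob_algebra sets S intro!: prob_space_restrict_space)
  show "on_line (restrict_space M S) = M"
  proof (rule measure_eqI)
    show "sets (on_line (restrict_space M S)) = sets M" by (simp add: on_line_def)
    fix E assume "E \<in> sets (on_line (restrict_space M S))"
    then have E: "E \<in> sets borel" by (simp add: on_line_def)
    have "emeasure (on_line (restrict_space M S)) E = emeasure (restrict_space M S) (E \<inter> S)"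
      unfolding on_line_def using E borel_probsD(3)[OF R]
      by (subst emeasure_distr) (auto intro: borel_measurable_borel_probs[OF R])
    also have "\<dots> = emeasure M (E \<inter> S)"
      using S by (subst emeasure_restrict_space) auto
    also have "\<dots> = emeasure M E"
      using AE E S by (intro emeasure_eq_AE) auto
    finally show "emeasure (on_line (restrict_space M S)) E = emeasure M E" .
  qed
qed

lemma on_line_inject:
  assumes "p \<in> borel_probs S" "p' \<in> borel_probs S" "S \<in> sets borel" "on_line p = on_line p'"
  shows "p = p'"
proof (rule measure_eqI)
  show "sets p = sets p'" using assms borel_probsD(2) by metis
  fix E assume "E \<in> sets p"
  then have "E \<in> sets (borel_on S)" using borel_probsD(2)[OF assms(1)] by simp
  then have E: "E \<in> sets borel" "E \<subseteq> S"
    using assms(3) by (auto simp: borel_on_def sets_restrict_space)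
  have "emeasure (on_line r) E = emeasure r E" if r: "r \<in> borel_probs S" for r
    unfolding on_line_def using E borel_probsD(3)[OF r]
    by (subst emeasure_distr) (auto intro: borel_measurable_borel_probs[OF r] simp: Int_absorb2)
  with assms show "emeasure p E = emeasure p' E" by metis
qed

text \<open>Tietze's theorem extends the integrand to a bounded continuous function on the line.\<close>

lemma weak_limit_integral:
  fixes f :: "real \<Rightarrow> real"
  assumes S: "closed S" and p: "\<And>n. p n \<in> borel_probs S" and l: "l \<in> borel_probs S"
    and conv: "weak_conv_m (\<lambda>n. on_line (p n)) (on_line l)"
    and f: "continuous_on S f" "bounded (f ` S)"
  shows "(\<lambda>n. \<integral>x. f x \<partial>p n) \<longlonglongrightarrow> (\<integral>x. f x \<partial>l)"
proof -
  obtain K where K: "K \<ge> 0" "\<And>x. x \<in> S \<Longrightarrow> norm (f x) \<le> K"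
    using f(2) unfolding bounded_pos by (auto intro: less_imp_le)
  obtain g where g: "continuous_on UNIV g" "\<And>x. x \<in> S \<Longrightarrow> g x = f x" "\<And>x. norm (g x) \<le> K"
    using Tietze[of S f UNIV K] f(1) S K by auto
  have [measurable]: "g \<in> borel_measurable borel"
    by (rule borel_measurable_continuous_onI[OF g(1)])
  have eq: "(\<integral>x. g x \<partial>on_line r) = (\<integral>x. f x \<partial>r)" if "r \<in> borel_probs S" for r
    unfolding integral_on_line[OF that \<open>g \<in> borel_measurable borel\<close>]
    using borel_probsD(3)[OF that] g(2) by (intro Bochner_Integration.integral_cong) auto
  have "(\<lambda>n. \<integral>x. g x \<partial>on_line (p n)) \<longlonglongrightarrow> (\<integral>x. g x \<partial>on_line l)"
    by (rule weak_conv_imp_integral_bdd_continuous_conv[OF real_distribution_on_line[OF p]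
          real_distribution_on_line[OF l] conv, of g K])
       (use g in \<open>auto simp: continuous_on_eq_continuous_at\<close>)
  then show ?thesis by (simp add: eq p l)
qed

text \<open>Helly's selection theorem gives a limit on the line. It is carried by \<open>S\<close>, since the integral of
the bounded continuous function \<open>min 1 (infdist x S)\<close> passes to the limit and vanishes along the
sequence.\<close>

lemma tight_has_weak_limit:
  assumes S: "closed S" and p: "\<And>n. p n \<in> borel_probs S" and tight: "tight (\<lambda>n. on_line (p n))"
  obtains r l where "strict_mono (r :: nat \<Rightarrow> nat)" "l \<in> borel_probs S"
    "weak_conv_m (\<lambda>n. on_line (p (r n))) (on_line l)"
proof -
  obtain r M where r: "strict_mono (r :: nat \<Rightarrow> nat)" and M: "real_distribution M"
    and conv: "weak_conv_m (\<lambda>n. on_line (p (r n))) M"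
    using tight_imp_convergent_subsubsequence[OF tight strict_mono_id] by (auto simp: o_def)
  interpret M: real_distribution M by (rule M)
  have ne: "S \<noteq> {}"
    using prob_space.not_empty[OF borel_probsD(1)[OF p]] borel_probsD(3)[OF p] by auto
  define f where "f x = min 1 (infdist x S)" for x
  have f: "continuous_on UNIV f" unfolding f_def by (intro continuous_intros)
  have [measurable]: "f \<in> borel_measurable borel" by (rule borel_measurable_continuous_onI[OF f])
  have f01: "0 \<le> f x" "norm (f x) \<le> 1" for x by (auto simp: f_def infdist_nonneg)
  have "(\<lambda>n. \<integral>x. f x \<partial>on_line (p (r n))) \<longlonglongrightarrow> (\<integral>x. f x \<partial>M)"
    by (rule weak_conv_imp_integral_bdd_continuous_conv[OF real_distribution_on_line[OF p] M conv, of f 1])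
       (use f f01 in \<open>auto simp: continuous_on_eq_continuous_at\<close>)
  moreover have "(\<integral>x. f x \<partial>on_line (p n)) = 0" for n
  proof -
    have "(\<integral>x. f x \<partial>p n) = (\<integral>x. 0 \<partial>p n)"
      using borel_probsD(3)[OF p] by (intro Bochner_Integration.integral_cong) (auto simp: f_def)
    then show ?thesis by (simp add: integral_on_line[OF p])
  qed
  ultimately have "(\<integral>x. f x \<partial>M) = 0"
    by (simp add: LIMSEQ_const_iff)
  moreover have "integrable M f"
    by (rule M.integrable_const_bound[of _ 1]) (use f01 in auto)
  ultimately have "AE x in M. f x = 0"
    using f01 by (subst integral_nonneg_eq_0_iff_AE[symmetric]) auto
  then have AE: "AE x in M. x \<in> S"
    by eventually_elim (use S ne in \<open>auto simp: f_def in_closed_iff_infdist_zero min_def split: if_splits\<close>)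
  have Sb: "S \<in> sets borel" using S by simp
  show thesis
    using that[OF r on_line_restrict_space(1)[OF M Sb AE]] conv on_line_restrict_space(2)[OF M Sb AE]
    by simp
qed

lemma tight_of_bounded_moment:
  assumes p: "\<And>n. p n \<in> borel_probs S" and m: "m \<ge> 1"
    and bd: "\<And>n. (\<integral>\<^sup>+ x. ennreal (\<bar>x\<bar> ^ m) \<partial>p n) \<le> ennreal K"
  shows "tight (\<lambda>n. on_line (p n))"
  unfolding tight_def
proof (intro conjI allI impI)
  show "real_distribution (on_line (p n))" for n by (rule real_distribution_on_line[OF p])
  fix e :: real assume e: "e > 0"
  \<comment> \<open>\<open>T \<ge> 1\<close> makes \<open>T \<le> \<bar>x\<bar> ^ m\<close> outside \<open>{- T<..T}\<close>; the second bound makes Markov's estimate \<open>K / T\<close> smaller than \<open>e\<close>.\<close>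
  define T where "T = max 1 ((\<bar>K\<bar> + 1) / e)"
  have T: "T \<ge> 1" "T > 0" "\<bar>K\<bar> + 1 \<le> e * T" using e by (auto simp: T_def max_def field_simps)
  have "measure (on_line (p n)) {- T <.. T} > 1 - e" for n
  proof -
    interpret D: real_distribution "on_line (p n)" by (rule real_distribution_on_line[OF p])
    let ?E = "{x::real. \<bar>x\<bar> \<ge> T}"
    have [measurable]: "?E \<in> sets borel" by measurable
    have "ennreal T * emeasure (on_line (p n)) ?E = (\<integral>\<^sup>+ x. ennreal T * indicator ?E x \<partial>on_line (p n))"
      by (subst nn_integral_cmult_indicator) auto
    also have "\<dots> \<le> (\<integral>\<^sup>+ x. ennreal (\<bar>x\<bar> ^ m) \<partial>on_line (p n))"
    proof (rule nn_integral_mono)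
      fix x :: real
      have "T \<le> \<bar>x\<bar> ^ m" if "\<bar>x\<bar> \<ge> T"
        using that T(1) m self_le_power[of "\<bar>x\<bar>" m] by simp
      then show "ennreal T * indicator ?E x \<le> ennreal (\<bar>x\<bar> ^ m)"
        by (auto simp: indicator_def intro: ennreal_leI)
    qed
    also have "\<dots> = (\<integral>\<^sup>+ x. ennreal (\<bar>x\<bar> ^ m) \<partial>p n)"
      unfolding on_line_def
      by (subst nn_integral_distr) (auto intro: borel_measurable_borel_probs[OF p])
    also have "\<dots> \<le> ennreal K" by (rule bd)
    also have "\<dots> \<le> ennreal \<bar>K\<bar>" by (rule ennreal_leI) simp
    finally have "T * measure (on_line (p n)) ?E \<le> \<bar>K\<bar>"
      using T by (simp add: D.emeasure_eq_measure flip: ennreal_mult)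
    also have "\<dots> < e * T" using T by simp
    finally have small: "measure (on_line (p n)) ?E < e"
      using T by (simp add: mult.commute)
    have "{- T <.. T} \<union> ?E = UNIV" using T by auto
    then have "1 \<le> measure (on_line (p n)) {- T <.. T} + measure (on_line (p n)) ?E"
      using measure_subadditive[of "{- T <.. T}" "on_line (p n)" ?E] D.prob_space
      by (simp add: D.emeasure_eq_measure)
    with small show ?thesis by simp
  qed
  then show "\<exists>a b. a < b \<and> (\<forall>n. measure (on_line (p n)) {a<..b} > 1 - e)"
    using T by (intro exI[of _ "- T"] exI[of _ T]) auto
qed

text \<open>Truncating \<open>f\<close> from above makes it bounded, so that its integrals converge and the limit
satisfies the bound for each truncation; monotone convergence then removes the truncation.\<close>

lemma weak_limit_integral_le:
  fixes f :: "real \<Rightarrow> real"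
  assumes S: "closed S" and p: "\<And>n. p n \<in> borel_probs S" and l: "l \<in> borel_probs S"
    and conv: "weak_conv_m (\<lambda>n. on_line (p n)) (on_line l)"
    and f: "continuous_on S f" and lower: "\<And>x. x \<in> S \<Longrightarrow> - K \<le> f x"
    and int: "\<And>n. integrable (p n) f"
    and le: "\<forall>\<^sub>F n in sequentially. (\<integral>x. f x \<partial>p n) \<le> \<beta> n" and \<beta>: "\<beta> \<longlonglongrightarrow> \<beta>'"
  shows "integrable l f \<and> (\<integral>x. f x \<partial>l) \<le> \<beta>'"
proof -
  interpret l: prob_space l by (rule borel_probsD[OF l])
  have "f \<in> borel_measurable (borel_on S)"
    unfolding borel_on_def by (rule borel_measurable_continuous_on_restrict[OF f])
  then have fl[measurable]: "f \<in> borel_measurable l" by (rule measurable_borel_probs[OF l])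
  define g where "g N x = min (f x) (real N)" for N x
  have gb: "\<bar>g N x\<bar> \<le> \<bar>K\<bar> + real N" "0 \<le> g N x + \<bar>K\<bar>" if "x \<in> S" for N x
    using lower[OF that] by (auto simp: g_def min_def)
  have g: "continuous_on S (g N)" "bounded (g N ` S)" for N
  proof -
    show "continuous_on S (g N)" unfolding g_def by (intro continuous_intros f)
    show "bounded (g N ` S)" using gb(1)[of _ N] by (auto intro!: boundedI)
  qed
  have gl: "integrable l (g N)" for N
  proof (rule l.integrable_const_bound[of _ "\<bar>K\<bar> + real N"])
    show "AE x in l. norm (g N x) \<le> \<bar>K\<bar> + real N"
      using gb(1) borel_probsD(3)[OF l] by (intro AE_I2) simp
    show "g N \<in> borel_measurable l" unfolding g_def by measurable
  qed
  have gle: "(\<integral>x. g N x \<partial>l) \<le> \<beta>'" for N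
  proof (rule tendsto_le[OF sequentially_bot \<beta> weak_limit_integral[OF S p l conv g]])
    show "\<forall>\<^sub>F n in sequentially. (\<integral>x. g N x \<partial>p n) \<le> \<beta> n"
      using le
    proof eventually_elim
      case (elim n)
      interpret pn: prob_space "p n" by (rule borel_probsD[OF p])
      have "integrable (p n) (g N)"
        using integrable_min[OF int[of n] pn.integrable_const[of "real N"]]
        by (simp add: g_def[abs_def] min_def)
      note gn = this
      then have "(\<integral>x. g N x \<partial>p n) \<le> (\<integral>x. f x \<partial>p n)"
        by (intro integral_mono[OF gn int]) (simp add: g_def)
      with elim show ?case by simp
    qed
  qed
  have lim: "(\<lambda>N. \<integral>\<^sup>+ x. ennreal (g N x + \<bar>K\<bar>) \<partial>l) \<longlonglongrightarrow> (\<integral>\<^sup>+ x. ennreal (f x + \<bar>K\<bar>) \<partial>l)"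
  proof (rule nn_integral_LIMSEQ)
    show "incseq (\<lambda>N x. ennreal (g N x + \<bar>K\<bar>))"
      by (auto simp: incseq_def le_fun_def g_def intro!: ennreal_leI)
    show "(\<lambda>x. ennreal (g N x + \<bar>K\<bar>)) \<in> borel_measurable l" for N
      using gl[of N] by measurable
    fix x
    have "\<forall>\<^sub>F N in sequentially. ennreal (g N x + \<bar>K\<bar>) = ennreal (f x + \<bar>K\<bar>)"
      using eventually_ge_at_top[of "nat \<lceil>f x\<rceil>"]
      by eventually_elim (auto simp: g_def min_def; linarith)
    then show "(\<lambda>N. ennreal (g N x + \<bar>K\<bar>)) \<longlonglongrightarrow> ennreal (f x + \<bar>K\<bar>)"
      by (rule tendsto_eventually)
  qed
  have nonneg: "AE x in l. 0 \<le> g N x + \<bar>K\<bar>" "AE x in l. 0 \<le> f x + \<bar>K\<bar>" for N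
  proof -
    have "0 \<le> f x + \<bar>K\<bar>" if "x \<in> S" for x using lower[OF that] by simp
    then show "AE x in l. 0 \<le> g N x + \<bar>K\<bar>" "AE x in l. 0 \<le> f x + \<bar>K\<bar>"
      using gb(2) borel_probsD(3)[OF l] by (intro AE_I2; simp)+
  qed
  have "(\<integral>\<^sup>+ x. ennreal (g N x + \<bar>K\<bar>) \<partial>l) \<le> ennreal (\<beta>' + \<bar>K\<bar>)" for N
  proof -
    have "(\<integral>\<^sup>+ x. ennreal (g N x + \<bar>K\<bar>) \<partial>l) = ennreal (\<integral>x. g N x + \<bar>K\<bar> \<partial>l)"
      using gl nonneg by (intro nn_integral_eq_integral) auto
    also have "\<dots> \<le> ennreal (\<beta>' + \<bar>K\<bar>)"
      using gle[of N] gl[of N] by (intro ennreal_leI) (simp add: l.prob_space)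
    finally show ?thesis .
  qed
  then have bound: "(\<integral>\<^sup>+ x. ennreal (f x + \<bar>K\<bar>) \<partial>l) \<le> ennreal (\<beta>' + \<bar>K\<bar>)"
    by (intro LIMSEQ_le_const2[OF lim]) auto
  then have "(\<integral>\<^sup>+ x. ennreal (f x + \<bar>K\<bar>) \<partial>l) < \<infinity>"
    by (rule le_less_trans) simp
  then have intK: "integrable l (\<lambda>x. f x + \<bar>K\<bar>)"
    using nonneg(2) by (intro integrableI_nonneg) auto
  then have fint: "integrable l f"
    using Bochner_Integration.integrable_diff[OF intK, of "\<lambda>_. \<bar>K\<bar>"] by simp
  have "ennreal (\<integral>x. f x + \<bar>K\<bar> \<partial>l) \<le> ennreal (\<beta>' + \<bar>K\<bar>)"
    using nn_integral_eq_integral[OF intK nonneg(2)] bound by simp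
  moreover have "0 \<le> \<beta>' + \<bar>K\<bar>"
  proof -
    have "0 \<le> (\<integral>x. g 0 x + \<bar>K\<bar> \<partial>l)" using nonneg(1) by (rule integral_nonneg_AE)
    then show ?thesis using gle[of 0] gl[of 0] by (simp add: l.prob_space)
  qed
  ultimately have "(\<integral>x. f x + \<bar>K\<bar> \<partial>l) \<le> \<beta>' + \<bar>K\<bar>" by simp
  then show ?thesis using fint by (simp add: l.prob_space)
qed

lemma tendsto_fun_iff:
  fixes x :: "nat \<Rightarrow> 'i \<Rightarrow> 'b::topological_space"
  shows "x \<longlonglongrightarrow> l \<longleftrightarrow> (\<forall>i. (\<lambda>n. x n i) \<longlonglongrightarrow> l i)"
  using limitin_componentwise[of "\<lambda>i::'i. euclidean :: 'b topology" UNIV x l sequentially]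
  by (simp add: euclidean_product_topology)

text \<open>Restricting characteristic functions to rational arguments loses nothing and makes the family of test
functions countable, hence the space of their values metrizable.\<close>

lemma char_eq_of_rational:
  assumes "real_distribution M" "real_distribution N"
    and eq: "\<And>t::rat. char M (of_rat t) = char N (of_rat t)"
  shows "M = N"
proof (rule Levy_uniqueness[OF assms(1,2)])
  have "continuous_on UNIV (char M)" "continuous_on UNIV (char N)"
    using real_distribution.isCont_char assms(1,2) by (auto simp: continuous_on_eq_continuous_at)
  then have "closed {t. char M t = char N t}" by (rule closed_Collect_eq)
  moreover have "\<rat> \<subseteq> {t. char M t = char N t}" using eq by (auto simp: Rats_def)
  ultimately have "closure \<rat> \<subseteq> {t. char M t = char N t}" by (rule closure_minimal[rotated])
  then show "char M = char N" by (auto simp: Rats_closure_real)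
qed

text \<open>Compactness is a statement about open covers, while the hypothesis speaks of sequences; the two meet in a
metric space. The map
\<open>\<Phi>\<close> to the values of the characteristic function at rational points takes \<open>K\<close> injectively
onto a sequentially compact, hence compact, set of functions. Its inverse is continuous into the
weak topology: along a convergent sequence of images, every subsequence of preimages has a weakly convergent
further subsequence, whose limit is determined by injectivity. So \<open>K\<close> is a continuous image of a
compact set.\<close>

lemma compactin_weak_topology:
  assumes S: "closed S" and K: "K \<subseteq> borel_probs S"
    and seq: "\<And>p. (\<And>n. p n \<in> K) \<Longrightarrow>
      \<exists>r l. strict_mono (r :: nat \<Rightarrow> nat) \<and> l \<in> K \<and> weak_conv_m (\<lambda>n. on_line (p (r n))) (on_line l)"
  shows "compactin (weak_topology S) K"
proof -
  have Sb: "S \<in> sets borel" using S by simp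
  define \<Phi> where "\<Phi> p = (\<lambda>t::rat. char (on_line p) (of_rat t))" for p
  have inj: "inj_on \<Phi> K"
  proof (rule inj_onI)
    fix p p' assume pp': "p \<in> K" "p' \<in> K" "\<Phi> p = \<Phi> p'"
    then have P: "p \<in> borel_probs S" "p' \<in> borel_probs S" using K by auto
    have "on_line p = on_line p'"
      by (rule char_eq_of_rational[OF real_distribution_on_line[OF P(1)] real_distribution_on_line[OF P(2)]])
         (use pp'(3) in \<open>auto simp: \<Phi>_def fun_eq_iff\<close>)
    then show "p = p'" by (rule on_line_inject[OF P Sb])
  qed
  have \<Phi>_conv: "(\<lambda>n. \<Phi> (p n)) \<longlonglongrightarrow> \<Phi> l"
    if "\<And>n. p n \<in> K" "l \<in> K" "weak_conv_m (\<lambda>n. on_line (p n)) (on_line l)" for p l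
    unfolding tendsto_fun_iff \<Phi>_def using that K
    by (intro allI levy_continuity1 real_distribution_on_line) auto
  have "seq_compact (\<Phi> ` K)"
    unfolding seq_compact_def
  proof (intro allI impI)
    fix y :: "nat \<Rightarrow> rat \<Rightarrow> complex" assume "\<forall>n. y n \<in> \<Phi> ` K"
    then obtain p where p: "\<And>n. p n \<in> K" "\<And>n. y n = \<Phi> (p n)"
      using choice[of "\<lambda>n p. p \<in> K \<and> y n = \<Phi> p"] by (auto simp: image_iff)
    obtain r l where r: "strict_mono (r :: nat \<Rightarrow> nat)" and l: "l \<in> K"
      and conv: "weak_conv_m (\<lambda>n. on_line (p (r n))) (on_line l)"
      using seq[of p, OF p(1)] by blast
    have "(y \<circ> r) \<longlonglongrightarrow> \<Phi> l"
      using \<Phi>_conv[of "\<lambda>n. p (r n)", OF p(1) l conv] by (simp only: o_def p(2))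
    with r l show "\<exists>l\<in>\<Phi> ` K. \<exists>r. strict_mono r \<and> (y \<circ> r) \<longlonglongrightarrow> l"
      by blast
  qed
  then have comp: "compact (\<Phi> ` K)"
    by (simp add: compact_eq_seq_compact_metric)
  define g where "g = inv_into K \<Phi>"
  have g: "g (\<Phi> p) = p" if "p \<in> K" for p using inj that by (simp add: g_def)
  have gK: "g y \<in> K" if "y \<in> \<Phi> ` K" for y using that g by auto
  have integral_cont: "continuous_on (\<Phi> ` K) (\<lambda>y. \<integral>x. f x \<partial>g y)"
    if f: "continuous_on S f" "bounded (f ` S)" for f :: "real \<Rightarrow> real"
  proof (rule continuous_on_sequentiallyI)
    fix y a assume y: "\<forall>n. y n \<in> \<Phi> ` K" and a: "a \<in> \<Phi> ` K" and ya: "y \<longlonglongrightarrow> a"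
    show "(\<lambda>n. \<integral>x. f x \<partial>g (y n)) \<longlonglongrightarrow> (\<integral>x. f x \<partial>g a)"
    proof (rule ccontr)
      assume "\<not> ?thesis"
      then obtain U where U: "open U" "(\<integral>x. f x \<partial>g a) \<in> U"
        and ev: "\<not> (\<forall>\<^sub>F n in sequentially. (\<integral>x. f x \<partial>g (y n)) \<in> U)"
        unfolding tendsto_def by blast
      obtain s where s: "strict_mono (s :: nat \<Rightarrow> nat)" and out: "\<And>n. (\<integral>x. f x \<partial>g (y (s n))) \<notin> U"
        using not_eventually_sequentiallyD[OF ev] by blast
      obtain r l where r: "strict_mono (r :: nat \<Rightarrow> nat)" and l: "l \<in> K"
        and conv: "weak_conv_m (\<lambda>n. on_line (g (y (s (r n))))) (on_line l)"
        using seq[of "\<lambda>n. g (y (s n))"] y gK by blast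
      have "(\<lambda>n. \<Phi> (g (y (s (r n))))) \<longlonglongrightarrow> \<Phi> l"
        by (rule \<Phi>_conv[OF _ l conv]) (use y gK in blast)
      moreover have "\<Phi> (g (y n)) = y n" for n using y g by (metis imageE)
      moreover have "(\<lambda>n. y (s (r n))) \<longlonglongrightarrow> a"
        using LIMSEQ_subseq_LIMSEQ[OF ya strict_mono_o[OF s r]] by (simp add: o_def)
      ultimately have "a = \<Phi> l" using LIMSEQ_unique by auto
      then have "g a = l" using g l by simp
      have "(\<lambda>n. \<integral>x. f x \<partial>g (y (s (r n)))) \<longlonglongrightarrow> (\<integral>x. f x \<partial>l)"
        by (rule weak_limit_integral[OF S _ _ conv f]) (use y gK K l in blast)+
      then have "\<forall>\<^sub>F n in sequentially. (\<integral>x. f x \<partial>g (y (s (r n)))) \<in> U"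
        using U \<open>g a = l\<close> unfolding tendsto_def by blast
      then show False using out by (auto simp: eventually_sequentially)
    qed
  qed
  have "continuous_map (top_of_set (\<Phi> ` K)) (weak_topology S) g"
    unfolding weak_topology_def
  proof (rule continuous_on_generated_topo)
    fix W assume "W \<in> {{\<mu> \<in> borel_probs S. (\<integral>x. f x \<partial>\<mu>) \<in> U} | f U.
        continuous_on S f \<and> bounded (f ` S) \<and> open (U :: real set)}"
    then obtain f and U :: "real set" where W: "W = {\<mu> \<in> borel_probs S. (\<integral>x. f x \<partial>\<mu>) \<in> U}"
      and f: "continuous_on S f" "bounded (f ` S)" and U: "open U" by blast
    have "g -` W \<inter> topspace (top_of_set (\<Phi> ` K)) = \<Phi> ` K \<inter> (\<lambda>y. \<integral>x. f x \<partial>g y) -` U"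
      using gK K unfolding W by auto
    then show "openin (top_of_set (\<Phi> ` K)) (g -` W \<inter> topspace (top_of_set (\<Phi> ` K)))"
      using continuous_openin_preimage_gen[OF integral_cont[OF f] U] by simp
  next
    let ?top = "{\<mu> \<in> borel_probs S. (\<integral>x. 0 \<partial>\<mu>) \<in> (UNIV :: real set)}"
    have "g ` topspace (top_of_set (\<Phi> ` K)) \<subseteq> ?top"
      using gK K by auto
    moreover have "?top \<in> {{\<mu> \<in> borel_probs S. (\<integral>x. f x \<partial>\<mu>) \<in> U} | f U.
        continuous_on S f \<and> bounded (f ` S) \<and> open (U :: real set)}"
      by (rule CollectI, rule exI[of _ "\<lambda>_. 0"], rule exI[of _ UNIV]) (auto intro!: boundedI[of _ 0])
    ultimately show "g ` topspace (top_of_set (\<Phi> ` K)) \<subseteq> \<Union> {{\<mu> \<in> borel_probs S. (\<integral>x. f x \<partial>\<mu>) \<in> U} | f U.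
        continuous_on S f \<and> bounded (f ` S) \<and> open (U :: real set)}"
      by (rule order_trans[OF _ Union_upper])
  qed
  moreover have "compactin (top_of_set (\<Phi> ` K)) (\<Phi> ` K)"
    using comp by (simp add: compactin_subtopology)
  ultimately have "compactin (weak_topology S) (g ` \<Phi> ` K)"
    by (rule image_compactin[rotated])
  moreover have "g ` \<Phi> ` K = K" using g by (force simp: image_image)
  ultimately show ?thesis by simp
qed

section \<open>Approachability\<close>

text \<open>Blackwell's argument. The state \<open>X n i\<close> is the accumulated deficit of coordinate \<open>i\<close>.
Replying to the weights \<open>max 0 (X n i)\<close> makes the cross term nonpositive when
the squared distance of the state from the nonpositive orthant is expanded, so that distance grows at most
like \<open>sqrt n\<close> and the average deficit
tends to \<open>0\<close>. This replaces a separating hyperplane argument in a space whose dimension varies with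
\<open>F\<close>.\<close>

lemma approachability:
  fixes g :: "'i \<Rightarrow> 'b \<Rightarrow> real"
  assumes F: "finite F"
    and L: "\<And>i b. i \<in> F \<Longrightarrow> b \<in> Y \<Longrightarrow> \<bar>g i b\<bar> \<le> L"
    and resp: "\<And>w. (\<And>i. i \<in> F \<Longrightarrow> 0 \<le> w i) \<Longrightarrow> \<exists>b\<in>Y. 0 \<le> (\<Sum>i\<in>F. w i * g i b)"
    and e: "e > 0"
  shows "\<exists>n b. n > 0 \<and> (\<forall>s. b s \<in> Y) \<and> (\<forall>i\<in>F. (\<Sum>s<n. g i (b s)) / real n \<ge> - e)"
proof -
  \<comment> \<open>\<open>R\<close> replies to the positive parts of a state; truncation makes every state a family of weights.\<close>
  have "\<forall>x. \<exists>b. b \<in> Y \<and> 0 \<le> (\<Sum>i\<in>F. max 0 (x i) * g i b)"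
    using resp by (metis max.cobounded1)
  then obtain R where R: "\<And>x. R x \<in> Y" "\<And>x. 0 \<le> (\<Sum>i\<in>F. max 0 (x i) * g i (R x))"
    by metis
  define X where "X = rec_nat (\<lambda>_. 0) (\<lambda>_ x i. x i - g i (R x))"
  have X0: "X 0 i = 0" and XS: "X (Suc n) i = X n i - g i (R (X n))" for n i
    by (simp_all add: X_def)
  define b where "b n = R (X n)" for n
  have Xsum: "X n i = - (\<Sum>s<n. g i (b s))" for n i
    by (induction n) (simp_all add: X0 XS b_def)
  have pot: "(\<Sum>i\<in>F. (max 0 (X n i))\<^sup>2) \<le> real n * (real (card F) * L\<^sup>2)" for n
  proof (induction n)
    case 0
    then show ?case by (simp add: X0)
  next
    case (Suc n)
    have step: "(max 0 (X (Suc n) i))\<^sup>2 \<le> (max 0 (X n i))\<^sup>2 - 2 * (max 0 (X n i) * g i (b n)) + L\<^sup>2"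
      if i: "i \<in> F" for i
    proof -
      have "max 0 (X (Suc n) i) \<le> \<bar>max 0 (X n i) - g i (b n)\<bar>"
        by (auto simp: XS b_def max_def)
      then have "(max 0 (X (Suc n) i))\<^sup>2 \<le> (max 0 (X n i) - g i (b n))\<^sup>2"
        by (metis abs_le_square_iff abs_of_nonneg max.cobounded1)
      also have "\<dots> = (max 0 (X n i))\<^sup>2 - 2 * (max 0 (X n i) * g i (b n)) + (g i (b n))\<^sup>2"
        by (simp add: power2_diff)
      also have "(g i (b n))\<^sup>2 \<le> L\<^sup>2"
        using L[OF i R(1), of "X n"] by (simp add: b_def abs_le_square_iff[symmetric])
      finally show ?thesis by simp
    qed
    have "(\<Sum>i\<in>F. (max 0 (X (Suc n) i))\<^sup>2)
        \<le> (\<Sum>i\<in>F. (max 0 (X n i))\<^sup>2 - 2 * (max 0 (X n i) * g i (b n)) + L\<^sup>2)"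
      by (rule sum_mono) (rule step)
    also have "\<dots> = (\<Sum>i\<in>F. (max 0 (X n i))\<^sup>2) - 2 * (\<Sum>i\<in>F. max 0 (X n i) * g i (b n)) + real (card F) * L\<^sup>2"
      by (simp add: sum.distrib sum_subtractf sum_distrib_left)
    also have "\<dots> \<le> real n * (real (card F) * L\<^sup>2) + real (card F) * L\<^sup>2"
      using Suc R(2)[of "X n"] by (simp add: b_def)
    finally show ?case by (simp add: algebra_simps)
  qed
  define n where "n = nat \<lceil>real (card F) * L\<^sup>2 / e\<^sup>2\<rceil> + 1"
  have n: "n > 0" "real (card F) * L\<^sup>2 \<le> real n * e\<^sup>2"
  proof -
    show "n > 0" by (simp add: n_def)
    have "real (card F) * L\<^sup>2 / e\<^sup>2 \<le> real n" unfolding n_def by linarith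
    then show "real (card F) * L\<^sup>2 \<le> real n * e\<^sup>2" using e by (simp add: field_simps)
  qed
  have "(\<Sum>s<n. g i (b s)) / real n \<ge> - e" if i: "i \<in> F" for i
  proof -
    have "(max 0 (X n i))\<^sup>2 \<le> (\<Sum>i\<in>F. (max 0 (X n i))\<^sup>2)"
      using F i by (intro member_le_sum) auto
    also have "\<dots> \<le> real n * (real (card F) * L\<^sup>2)" by (rule pot)
    also have "\<dots> \<le> real n * (real n * e\<^sup>2)" using n by (intro mult_left_mono) auto
    also have "\<dots> = (real n * e)\<^sup>2" by (simp add: power2_eq_square)
    finally have "max 0 (X n i) \<le> real n * e"
      by (rule power2_le_imp_le) (use e in simp)
    then show ?thesis using n(1) by (simp add: Xsum field_simps)
  qed
  then show ?thesis using n(1) R(1) by (intro exI[of _ n] exI[of _ b]) (auto simp: b_def)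
qed

section \<open>Finitely supported strategies\<close>

text \<open>Both the mixtures of Player I and the empirical distributions of Player II that occur in the minimax
argument are of this form.\<close>

lemma finitely_supported_strategy:
  fixes P :: "'i pmf" and h :: "'i \<Rightarrow> 'a::topological_space"
  assumes S: "S \<in> sets borel" and h: "\<And>i. h i \<in> S" and fin: "finite F" "set_pmf P \<subseteq> F"
  defines "p \<equiv> distr (measure_pmf P) (borel_on S) h"
  shows "p \<in> borel_probs S"
    and "\<And>f :: 'a \<Rightarrow> real. f \<in> borel_measurable (borel_on S) \<Longrightarrow> integrable p f"
    and "\<And>f :: 'a \<Rightarrow> real. f \<in> borel_measurable (borel_on S) \<Longrightarrow> (\<integral>x. f x \<partial>p) = (\<Sum>i\<in>F. pmf P i * f (h i))"
proof -
  have meas: "h \<in> measure_pmf P \<rightarrow>\<^sub>M borel_on S" using h by simp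
  show "p \<in> borel_probs S"
    unfolding borel_probs_def space_prob_algebra p_def
    using measure_pmf.prob_space_distr[OF meas] by simp
  fix f :: "'a \<Rightarrow> real" assume f: "f \<in> borel_measurable (borel_on S)"
  have "finite (set_pmf P)" using fin finite_subset by blast
  then show "integrable p f"
    unfolding p_def by (subst integrable_distr_eq[OF meas f]) (rule integrable_measure_pmf_finite)
  show "(\<integral>x. f x \<partial>p) = (\<Sum>i\<in>F. pmf P i * f (h i))"
    unfolding p_def integral_distr[OF meas f]
    by (subst integral_measure_pmf[OF fin(1)]) (use fin in auto)
qed

section \<open>Difference games on the half-line\<close>

lemma measurable_difference:
  fixes \<phi> :: "real \<Rightarrow> real"
  assumes "continuous_on UNIV \<phi>"
  shows "(\<lambda>(a, b). \<phi> (a - b)) \<in> borel_measurable borel"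
proof -
  have "continuous_on UNIV (\<lambda>x::real \<times> real. \<phi> (fst x - snd x))"
    by (intro continuous_on_compose2[OF assms] continuous_intros) auto
  then show ?thesis
    using borel_measurable_continuous_onI by (simp add: case_prod_beta')
qed

lemma measurable_game_difference:
  fixes \<phi> :: "real \<Rightarrow> real"
  assumes "continuous_on UNIV \<phi>"
  shows "measurable_game {0..} {0..} (\<lambda>a b. \<phi> (a - b))"
proof
  have id: "(\<lambda>x. x) \<in> borel_on {0..} \<rightarrow>\<^sub>M (borel :: real measure)"
    by (rule measurable_borel_on) simp
  have "(\<lambda>x. (fst x, snd x)) \<in> borel_on {0..} \<Otimes>\<^sub>M borel_on {0..} \<rightarrow>\<^sub>M (borel :: real measure) \<Otimes>\<^sub>M (borel :: real measure)"
    using measurable_compose[OF measurable_fst id] measurable_compose[OF measurable_snd id]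
    by (intro measurable_Pair) auto
  then have "(\<lambda>x. x) \<in> borel_on {0..} \<Otimes>\<^sub>M borel_on {0..} \<rightarrow>\<^sub>M (borel :: (real \<times> real) measure)"
    by (simp add: borel_prod)
  from measurable_compose[OF this measurable_difference[OF assms]]
  show "(\<lambda>(a, b). \<phi> (a - b)) \<in> borel_measurable (borel_on {0..} \<Otimes>\<^sub>M borel_on {0..})" .
qed

section \<open>Difference games of odd growth\<close>

text \<open>The last two bounds are the first two for \<open>\<lambda>s. - \<phi> (- s)\<close>, whose game is the one with the
players exchanged. The same constants serve on both sides so that the exchange is an interpretation of the
locale in itself.\<close>

locale odd_growth =
  fixes \<phi> :: "real \<Rightarrow> real" and m :: nat and k C :: real
  assumes continuous: "continuous_on UNIV \<phi>"
    and m: "m \<ge> 1" and k: "k > 0"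
    and right_lower: "\<And>s. s \<ge> 0 \<Longrightarrow> k * s ^ m - C \<le> \<phi> s"
    and right_upper: "\<And>s. s \<ge> 0 \<Longrightarrow> \<phi> s \<le> C * (1 + s ^ m)"
    and left_lower: "\<And>s. s \<ge> 0 \<Longrightarrow> k * s ^ m - C \<le> - \<phi> (- s)"
    and left_upper: "\<And>s. s \<ge> 0 \<Longrightarrow> - \<phi> (- s) \<le> C * (1 + s ^ m)"
begin

lemma odd_growth_reversed: "odd_growth (\<lambda>s. - \<phi> (- s)) m k C"
proof
  show "continuous_on UNIV (\<lambda>s. - \<phi> (- s))"
    by (intro continuous_intros continuous_on_compose2[OF continuous]) auto
qed (use m k right_lower right_upper left_lower left_upper in auto)

lemma zero_power_m [simp]: "(0::real) ^ m = 0"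
  using m by simp

lemma C_nonneg: "0 \<le> C"
  using right_lower[of 0] right_upper[of 0] by simp

lemma payoff_upper:
  assumes "a \<ge> 0" "b \<ge> 0"
  shows "\<phi> (a - b) \<le> C * (1 + a ^ m)"
proof (cases "a \<ge> b")
  case True
  have "\<phi> (a - b) \<le> C * (1 + (a - b) ^ m)" using right_upper True by simp
  also have "\<dots> \<le> C * (1 + a ^ m)"
    using assms True C_nonneg by (intro mult_left_mono add_left_mono power_mono) auto
  finally show ?thesis .
next
  case False
  have "k * (b - a) ^ m - C \<le> - \<phi> (a - b)" using left_lower[of "b - a"] False by simp
  moreover have "0 \<le> k * (b - a) ^ m" using k False by simp
  moreover have "0 \<le> C * a ^ m" using C_nonneg assms by simp
  ultimately show ?thesis by (simp add: algebra_simps)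
qed

end

context odd_growth
begin

interpretation reversed: odd_growth "\<lambda>s. - \<phi> (- s)" m k C
  by (rule odd_growth_reversed)

lemma payoff_lower: "a \<ge> 0 \<Longrightarrow> b \<ge> 0 \<Longrightarrow> - (C * (1 + b ^ m)) \<le> \<phi> (a - b)"
  using reversed.payoff_upper[of b a] by simp

lemma abs_payoff_le: "a \<ge> 0 \<Longrightarrow> b \<ge> 0 \<Longrightarrow> \<bar>\<phi> (a - b)\<bar> \<le> C * (2 + a ^ m + b ^ m)"
proof -
  assume ab: "a \<ge> 0" "b \<ge> 0"
  have "0 \<le> C * (1 + a ^ m)" "0 \<le> C * (1 + b ^ m)" using C_nonneg ab by simp_all
  then show ?thesis using payoff_lower[OF ab] payoff_upper[OF ab] by (simp add: algebra_simps abs_le_iff)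
qed

text \<open>The factor \<open>2 ^ m\<close> comes from \<open>a ^ m \<le> 2 ^ m * max (a - b) b ^ m\<close>, and \<open>k\<close> is the
lower growth constant; the terms with \<open>C\<close> make up for the additive constant of the lower bound and for the negative
values of \<open>\<phi>\<close> when \<open>a < b\<close>.\<close>

definition slope :: real where "slope = 2 ^ m / k"
definition offset :: "real \<Rightarrow> real" where "offset b = 2 ^ m * ((2 * C + C * b ^ m) / k + b ^ m)"

lemma slope_nonneg: "0 \<le> slope" using k by (simp add: slope_def)

lemma offset_nonneg: "b \<ge> 0 \<Longrightarrow> 0 \<le> offset b"
  using k C_nonneg by (simp add: offset_def)

text \<open>Coercivity: this estimate is the source of all integrability and tightness below.\<close>

lemma power_le_payoff:
  assumes "a \<ge> 0" "b \<ge> 0"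
  shows "a ^ m \<le> slope * \<phi> (a - b) + offset b"
proof -
  have *: "slope * \<phi> (a - b) + offset b = 2 ^ m * ((\<phi> (a - b) + 2 * C + C * b ^ m) / k + b ^ m)"
    using k by (simp add: slope_def offset_def field_simps)
  have Cb: "0 \<le> C * b ^ m" using C_nonneg assms by simp
  show ?thesis
  proof (cases "a \<ge> b")
    case True
    define t where "t = max (a - b) b"
    have t: "0 \<le> a - b" "a \<le> 2 * t" "0 \<le> t" using True assms by (auto simp: t_def max_def)
    have "a ^ m \<le> (2 * t) ^ m" using t assms by (intro power_mono) auto
    also have "\<dots> = 2 ^ m * t ^ m" by (rule power_mult_distrib)
    also have "t ^ m \<le> (a - b) ^ m + b ^ m"
      using t assms by (auto simp: t_def max_def)
    also have "(a - b) ^ m \<le> (\<phi> (a - b) + 2 * C + C * b ^ m) / k"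
      using right_lower[OF t(1)] k C_nonneg Cb by (simp add: field_simps)
    finally show ?thesis unfolding * by simp
  next
    case False
    have "0 \<le> (\<phi> (a - b) + 2 * C + C * b ^ m) / k"
      using payoff_lower[OF assms] k C_nonneg by (simp add: algebra_simps)
    moreover have "a ^ m \<le> b ^ m" using False assms by (intro power_mono) auto
    moreover have "b ^ m \<le> 2 ^ m * b ^ m"
      using assms mult_right_mono[of 1 "2 ^ m" "b ^ m"] by simp
    moreover have "2 ^ m * b ^ m \<le> 2 ^ m * ((\<phi> (a - b) + 2 * C + C * b ^ m) / k + b ^ m)"
      using \<open>0 \<le> (\<phi> (a - b) + 2 * C + C * b ^ m) / k\<close> by (intro mult_left_mono) auto
    ultimately show ?thesis unfolding * by linarith
  qed
qed

sublocale measurable_game "{0..}" "{0..}" "\<lambda>a b. \<phi> (a - b)"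
  by (rule measurable_game_difference[OF continuous])

definition moment_finite :: "real measure \<Rightarrow> bool" where
  "moment_finite p \<longleftrightarrow> integrable p (\<lambda>x. x ^ m)"

lemma moment_finiteI:
  assumes p: "p \<in> borel_probs {0..}" and "(\<integral>\<^sup>+ x. ennreal (x ^ m) \<partial>p) \<noteq> \<infinity>"
  shows "moment_finite p"
  unfolding moment_finite_def
proof (rule integrableI_nonneg)
  show "(\<lambda>x. x ^ m) \<in> borel_measurable p" by (rule borel_measurable_borel_probs[OF p]) simp
  show "AE x in p. 0 \<le> x ^ m" using borel_probsD(3)[OF p] by (intro AE_I2) simp
qed (use assms(2) in \<open>simp add: less_top\<close>)

lemma measurable_payoff_at [measurable]: "(\<lambda>a. \<phi> (a - b)) \<in> borel_measurable borel"
  by (intro borel_measurable_continuous_onI continuous_on_compose2[OF continuous] continuous_intros) auto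

lemma integrable_payoff:
  assumes p: "p \<in> borel_probs {0..}" and fin: "moment_finite p" and b: "b \<ge> 0"
  shows "integrable p (\<lambda>a. \<phi> (a - b))"
proof (rule Bochner_Integration.integrable_bound)
  interpret prob_space p by (rule borel_probsD[OF p])
  show "integrable p (\<lambda>a. C * (2 + a ^ m + b ^ m))"
    using fin unfolding moment_finite_def by simp
  show "(\<lambda>a. \<phi> (a - b)) \<in> borel_measurable p"
    by (rule borel_measurable_borel_probs[OF p measurable_payoff_at])
  show "AE a in p. norm (\<phi> (a - b)) \<le> norm (C * (2 + a ^ m + b ^ m))"
    using abs_payoff_le b borel_probsD(3)[OF p] by (intro AE_I2) (simp, smt (verit))
qed

lemma moment_finite_if_integrable:
  assumes p: "p \<in> borel_probs {0..}" and b: "b \<ge> 0" and int: "integrable p (\<lambda>a. \<phi> (a - b))"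
  shows "moment_finite p"
  unfolding moment_finite_def
proof (rule Bochner_Integration.integrable_bound)
  interpret prob_space p by (rule borel_probsD[OF p])
  show "integrable p (\<lambda>a. slope * \<phi> (a - b) + offset b)"
    using int by simp
  show "(\<lambda>x. x ^ m) \<in> borel_measurable p" by (rule borel_measurable_borel_probs[OF p]) simp
  show "AE a in p. norm (a ^ m) \<le> norm (slope * \<phi> (a - b) + offset b)"
  proof (rule AE_I2)
    fix a assume "a \<in> space p"
    then have "a \<ge> 0" using borel_probsD(3)[OF p] by simp
    then show "norm (a ^ m) \<le> norm (slope * \<phi> (a - b) + offset b)"
      using power_le_payoff[OF _ b, of a] zero_le_power[of a m] by (simp add: abs_le_iff)
  qed
qed

text \<open>The positive part of a single payoff function controls the moment, and conversely the moment dominates all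
payoff functions at once. So a strategy either has integrable payoff against every pure reply or an infinite
expected gain against every pure reply.\<close>

lemma moment_finite_if_nn_integral_finite:
  assumes p: "p \<in> borel_probs {0..}" and b: "b \<ge> 0"
    and fin: "(\<integral>\<^sup>+ a. ennreal (\<phi> (a - b)) \<partial>p) \<noteq> \<infinity>"
  shows "moment_finite p"
proof (rule moment_finiteI[OF p])
  interpret prob_space p by (rule borel_probsD[OF p])
  have [measurable]: "(\<lambda>a. \<phi> (a - b)) \<in> borel_measurable p"
    by (rule borel_measurable_borel_probs[OF p measurable_payoff_at])
  have "(\<integral>\<^sup>+ a. ennreal (a ^ m) \<partial>p) \<le> (\<integral>\<^sup>+ a. ennreal slope * ennreal (\<phi> (a - b)) + ennreal (offset b) \<partial>p)"
  proof (rule nn_integral_mono)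
    fix a assume "a \<in> space p"
    then have a: "a \<ge> 0" using borel_probsD(3)[OF p] by simp
    have "a ^ m \<le> slope * max 0 (\<phi> (a - b)) + offset b"
      using power_le_payoff[OF a b] mult_left_mono[OF max.cobounded2[of "\<phi> (a - b)" 0] slope_nonneg] by linarith
    then have "ennreal (a ^ m) \<le> ennreal (slope * max 0 (\<phi> (a - b)) + offset b)" by (rule ennreal_leI)
    then show "ennreal (a ^ m) \<le> ennreal slope * ennreal (\<phi> (a - b)) + ennreal (offset b)"
      using slope_nonneg offset_nonneg[OF b]
      by (simp add: ennreal_plus ennreal_mult ennreal_max_0 max.commute[of 0])
  qed
  also have "\<dots> = ennreal slope * (\<integral>\<^sup>+ a. ennreal (\<phi> (a - b)) \<partial>p) + ennreal (offset b)"
    by (simp add: nn_integral_add nn_integral_cmult emeasure_space_1)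
  finally show "(\<integral>\<^sup>+ a. ennreal (a ^ m) \<partial>p) \<noteq> \<infinity>"
    using fin by (auto simp: top_unique ennreal_mult_eq_top_iff)
qed

lemma moment_finite_if_payoff_finite:
  assumes p: "p \<in> borel_probs {0..}" and b: "b \<ge> 0"
    and finite: "payoff (\<lambda>a b. \<phi> (a - b)) p (dirac {0..} b) \<noteq> \<infinity>"
  shows "moment_finite p"
proof (rule moment_finite_if_nn_integral_finite[OF p b])
  have "gain (\<lambda>a b. \<phi> (a - b)) p (dirac {0..} b) \<noteq> \<infinity>"
    using finite by (auto simp: payoff_eq_gain)
  then show "(\<integral>\<^sup>+ a. ennreal (\<phi> (a - b)) \<partial>p) \<noteq> \<infinity>"
    using gain_dirac_II[OF _ p] b by simp
qed

lemma payoff_pure_II: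
  assumes "p \<in> borel_probs {0..}" "moment_finite p" "b \<ge> 0"
  shows "payoff (\<lambda>a b. \<phi> (a - b)) p (dirac {0..} b) = ereal (\<integral>a. \<phi> (a - b) \<partial>p)"
  using assms integrable_payoff by (intro payoff_dirac_II) auto

text \<open>The bound \<open>payoff_upper\<close> does not depend on \<open>b\<close>, so the positive part stays integrable against
every strategy of Player II, however heavy its tail.\<close>

lemma sensible_if_moment_finite:
  assumes p: "p \<in> borel_probs {0..}" and fin: "moment_finite p"
  shows "p \<in> sensible_I {0..} {0..} (\<lambda>a b. \<phi> (a - b))"
proof -
  interpret p: prob_space p by (rule borel_probsD[OF p])
  have "gain (\<lambda>a b. \<phi> (a - b)) p q \<noteq> \<infinity>" if q: "q \<in> borel_probs {0..}" for q
  proof -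
    interpret q: prob_space q by (rule borel_probsD[OF q])
    have "gain (\<lambda>a b. \<phi> (a - b)) p q \<le> (\<integral>\<^sup>+ a. (\<integral>\<^sup>+ b. ennreal (C * (1 + a ^ m)) \<partial>q) \<partial>p)"
      unfolding gain_def using payoff_upper borel_probsD(3)[OF p] borel_probsD(3)[OF q]
      by (intro nn_integral_mono ennreal_leI) simp
    also have "\<dots> = (\<integral>\<^sup>+ a. ennreal (C * (1 + a ^ m)) \<partial>p)" by (simp add: q.emeasure_space_1)
    also have "\<dots> = ennreal (\<integral>a. C * (1 + a ^ m) \<partial>p)"
      using fin C_nonneg borel_probsD(3)[OF p] unfolding moment_finite_def
      by (intro nn_integral_eq_integral AE_I2) auto
    finally show ?thesis by (auto simp: top_unique)
  qed
  then show ?thesis using p by (auto simp: sensible_I_def payoff_defined_iff_gain)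
qed

lemma moment_finite_if_sharp_finite:
  assumes "p \<in> borel_probs {0..}" "payoff_sharp {0..} (\<lambda>a b. \<phi> (a - b)) p \<noteq> \<infinity>"
  shows "moment_finite p"
proof (rule moment_finite_if_payoff_finite[OF assms(1), of 0])
  have "payoff (\<lambda>a b. \<phi> (a - b)) p (dirac {0..} 0) \<le> payoff_sharp {0..} (\<lambda>a b. \<phi> (a - b)) p"
    unfolding payoff_sharp_def by (rule SUP_upper) simp
  then show "payoff (\<lambda>a b. \<phi> (a - b)) p (dirac {0..} 0) \<noteq> \<infinity>" using assms(2) by auto
qed simp

lemma moment_finite_dirac: "a \<ge> 0 \<Longrightarrow> moment_finite (dirac {0..} a)"
proof (rule moment_finiteI)
  assume "a \<ge> 0"
  then show "dirac {0..} a \<in> borel_probs {0..}" by (simp add: dirac_in_borel_probs)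
  have "(\<lambda>x::real. ennreal (x ^ m)) \<in> borel_measurable (borel_on {0..})"
    by (rule measurable_compose[OF measurable_borel_on]) auto
  then show "(\<integral>\<^sup>+ x. ennreal (x ^ m) \<partial>dirac {0..} a) \<noteq> \<infinity>"
    unfolding dirac_def using \<open>a \<ge> 0\<close> by (subst nn_integral_return) auto
qed

lemma payoff_defined_pure_I:
  "a \<ge> 0 \<Longrightarrow> q \<in> borel_probs {0..} \<Longrightarrow> payoff_defined (\<lambda>a b. \<phi> (a - b)) (dirac {0..} a) q"
  using sensible_if_moment_finite[OF dirac_in_borel_probs moment_finite_dirac, of a]
  by (auto simp: sensible_I_def)

lemma payoff_pure_pure:
  assumes "a \<ge> 0" "b \<ge> 0"
  shows "payoff (\<lambda>a b. \<phi> (a - b)) (dirac {0..} a) (dirac {0..} b) = ereal (\<phi> (a - b))"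
proof -
  have "dirac {0..} a \<in> borel_probs {0..}" using assms by (simp add: dirac_in_borel_probs)
  moreover have "(\<integral>x. \<phi> (x - b) \<partial>dirac {0..} a) = \<phi> (a - b)"
    unfolding dirac_def using assms measurable_payoff_I[of b] by (subst integral_return) auto
  ultimately show ?thesis using payoff_pure_II moment_finite_dirac assms by simp
qed

lemma v_sharp_le: "v_sharp {0..} {0..} (\<lambda>a b. \<phi> (a - b)) \<le> ereal C"
proof -
  have "v_sharp {0..} {0..} (\<lambda>a b. \<phi> (a - b)) \<le> payoff_sharp {0..} (\<lambda>a b. \<phi> (a - b)) (dirac {0..} 0)"
    unfolding v_sharp_def
    by (intro INF_lower sensible_if_moment_finite dirac_in_borel_probs moment_finite_dirac) auto
  also have "\<dots> \<le> ereal C"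
    unfolding payoff_sharp_def using payoff_upper[of 0] by (intro SUP_least) (simp add: payoff_pure_pure)
  finally show ?thesis .
qed

lemma v_sharp_ge: "v_sharp {0..} {0..} (\<lambda>a b. \<phi> (a - b)) \<ge> ereal (- C)"
  unfolding v_sharp_def
proof (rule INF_greatest)
  fix p assume "p \<in> sensible_I {0..} {0..} (\<lambda>a b. \<phi> (a - b))"
  then have p: "p \<in> borel_probs {0..}" by (simp add: sensible_I_def)
  have "ereal (- C) \<le> payoff (\<lambda>a b. \<phi> (a - b)) p (dirac {0..} 0)"
  proof (rule payoff_ge_of_dirac[OF p dirac_in_borel_probs])
    show "ereal (- C) \<le> payoff (\<lambda>a b. \<phi> (a - b)) (dirac {0..} a) (dirac {0..} 0)" if "a \<in> {0..}" for a
      using payoff_lower[of a 0] that by (simp add: payoff_pure_pure)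
  qed simp
  also have "\<dots> \<le> payoff_sharp {0..} (\<lambda>a b. \<phi> (a - b)) p"
    unfolding payoff_sharp_def by (rule SUP_upper) simp
  finally show "ereal (- C) \<le> payoff_sharp {0..} (\<lambda>a b. \<phi> (a - b)) p" .
qed

text \<open>Integrating the coercivity estimate bounds the moments, and Markov's inequality gives tightness.\<close>

lemma bounded_payoff_weak_limit:
  assumes p: "\<And>n. p n \<in> borel_probs {0..}" and fin: "\<And>n. moment_finite (p n)"
    and b: "b \<ge> 0" and le: "\<And>n. (\<integral>a. \<phi> (a - b) \<partial>p n) \<le> K"
  obtains r l where "strict_mono (r :: nat \<Rightarrow> nat)" "l \<in> borel_probs {0..}"
    "weak_conv_m (\<lambda>n. on_line (p (r n))) (on_line l)"
proof (rule tight_has_weak_limit[of "{0..}" p])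
  show "tight (\<lambda>n. on_line (p n))"
  proof (rule tight_of_bounded_moment[OF p m])
    fix n
    interpret prob_space "p n" by (rule borel_probsD[OF p])
    have "(\<integral>\<^sup>+ x. ennreal (\<bar>x\<bar> ^ m) \<partial>p n) = (\<integral>\<^sup>+ x. ennreal (x ^ m) \<partial>p n)"
      using borel_probsD(3)[OF p] by (intro nn_integral_cong) simp
    also have "\<dots> = ennreal (\<integral>x. x ^ m \<partial>p n)"
      using fin[of n] borel_probsD(3)[OF p] unfolding moment_finite_def
      by (intro nn_integral_eq_integral AE_I2) auto
    also have "(\<integral>x. x ^ m \<partial>p n) \<le> (\<integral>x. slope * \<phi> (x - b) + offset b \<partial>p n)"
      using fin[of n] integrable_payoff[OF p fin b] borel_probsD(3)[OF p] power_le_payoff[OF _ b]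
      unfolding moment_finite_def by (intro integral_mono) auto
    also have "\<dots> = slope * (\<integral>x. \<phi> (x - b) \<partial>p n) + offset b"
      using integrable_payoff[OF p fin b] by (simp add: prob_space)
    also have "\<dots> \<le> slope * K + offset b"
      using mult_left_mono[OF le slope_nonneg] by simp
    finally show "(\<integral>\<^sup>+ x. ennreal (\<bar>x\<bar> ^ m) \<partial>p n) \<le> ennreal (slope * K + offset b)"
      by (simp add: ennreal_leI)
  qed
qed (use p that in auto)

text \<open>The payoff against a pure strategy is continuous and bounded below, so it is lower semicontinuous under
weak convergence.\<close>

lemma payoff_weak_limit:
  assumes p: "\<And>n. p n \<in> borel_probs {0..}" and fin: "\<And>n. moment_finite (p n)"
    and l: "l \<in> borel_probs {0..}" and conv: "weak_conv_m (\<lambda>n. on_line (p n)) (on_line l)"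
    and b: "b \<ge> 0" and le: "\<forall>\<^sub>F n in sequentially. (\<integral>a. \<phi> (a - b) \<partial>p n) \<le> \<beta> n"
    and \<beta>: "\<beta> \<longlonglongrightarrow> \<beta>'"
  shows "moment_finite l \<and> (\<integral>a. \<phi> (a - b) \<partial>l) \<le> \<beta>'"
proof -
  have "continuous_on {0..} (\<lambda>a. \<phi> (a - b))"
    by (intro continuous_on_compose2[OF continuous] continuous_intros) auto
  from weak_limit_integral_le[OF _ p l conv this _ integrable_payoff[OF p fin b] le \<beta>, of "C * (1 + b ^ m)"]
  have "integrable l (\<lambda>a. \<phi> (a - b)) \<and> (\<integral>a. \<phi> (a - b) \<partial>l) \<le> \<beta>'"
    using payoff_lower b by auto
  then show ?thesis using moment_finite_if_integrable[OF l b] by blast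
qed

lemma P_sharp_iff:
  "p \<in> P_sharp {0..} {0..} (\<lambda>a b. \<phi> (a - b)) (ereal v) \<longleftrightarrow>
     p \<in> borel_probs {0..} \<and> moment_finite p \<and> (\<forall>b\<ge>0. (\<integral>a. \<phi> (a - b) \<partial>p) \<le> v)"
proof -
  have "moment_finite p" if "p \<in> borel_probs {0..}" "payoff_sharp {0..} (\<lambda>a b. \<phi> (a - b)) p \<le> ereal v"
    using that by (intro moment_finite_if_sharp_finite) auto
  then show ?thesis
    by (auto simp: P_sharp_def payoff_sharp_def SUP_le_iff payoff_pure_II)
qed

text \<open>Letting the levels vary serves two purposes: constant levels give compactness of a sublevel set, and levels
decreasing to \<open>v_sharp\<close> give an optimal strategy.\<close>

lemma P_sharp_subseq_limit:
  assumes p: "\<And>n. p n \<in> P_sharp {0..} {0..} (\<lambda>a b. \<phi> (a - b)) (ereal (\<beta> n))" and \<beta>: "\<beta> \<longlonglongrightarrow> v"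
  shows "\<exists>r l. strict_mono (r :: nat \<Rightarrow> nat) \<and> l \<in> P_sharp {0..} {0..} (\<lambda>a b. \<phi> (a - b)) (ereal v)
    \<and> weak_conv_m (\<lambda>n. on_line (p (r n))) (on_line l)"
proof -
  obtain K where K: "\<And>n. \<beta> n \<le> K"
    using convergent_imp_bounded[OF \<beta>] 
    by (auto simp: bounded_iff) (metis abs_le_D1)
  have pn: "p n \<in> borel_probs {0..}" "moment_finite (p n)" "b \<ge> 0 \<Longrightarrow> (\<integral>a. \<phi> (a - b) \<partial>p n) \<le> \<beta> n" for n b
    using p[of n] by (auto simp: P_sharp_iff)
  obtain r l where r: "strict_mono (r :: nat \<Rightarrow> nat)" and l: "l \<in> borel_probs {0..}"
    and conv: "weak_conv_m (\<lambda>n. on_line (p (r n))) (on_line l)"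
    using bounded_payoff_weak_limit[of p 0 K] pn K by (metis order_refl order_trans)
  have "moment_finite l \<and> (\<integral>a. \<phi> (a - b) \<partial>l) \<le> v" if b: "b \<ge> 0" for b
  proof (rule payoff_weak_limit[OF _ _ l conv b])
    show "(\<lambda>n. \<beta> (r n)) \<longlonglongrightarrow> v" using LIMSEQ_subseq_LIMSEQ[OF \<beta> r] by (simp add: o_def)
  qed (use pn b in auto)
  then have "l \<in> P_sharp {0..} {0..} (\<lambda>a b. \<phi> (a - b)) (ereal v)"
    using l by (auto simp: P_sharp_iff intro: order_refl)
  with r conv show ?thesis by blast
qed

lemma compactin_P_sharp:
  "compactin (weak_topology {0..}) (P_sharp {0..} {0..} (\<lambda>a b. \<phi> (a - b)) (ereal v))"
proof (rule compactin_weak_topology)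
  fix p :: "nat \<Rightarrow> real measure"
  assume "\<And>n. p n \<in> P_sharp {0..} {0..} (\<lambda>a b. \<phi> (a - b)) (ereal v)"
  then show "\<exists>r l. strict_mono (r :: nat \<Rightarrow> nat) \<and> l \<in> P_sharp {0..} {0..} (\<lambda>a b. \<phi> (a - b)) (ereal v)
      \<and> weak_conv_m (\<lambda>n. on_line (p (r n))) (on_line l)"
    by (rule P_sharp_subseq_limit) simp
qed (auto simp: P_sharp_def)

lemma P_sharp_nonempty:
  assumes v: "v_sharp {0..} {0..} (\<lambda>a b. \<phi> (a - b)) = ereal v"
  shows "P_sharp {0..} {0..} (\<lambda>a b. \<phi> (a - b)) (ereal v) \<noteq> {}"
proof -
  have "\<exists>p. p \<in> P_sharp {0..} {0..} (\<lambda>a b. \<phi> (a - b)) (ereal (v + inverse (real (Suc n))))" for n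
  proof -
    have "v_sharp {0..} {0..} (\<lambda>a b. \<phi> (a - b)) < ereal (v + inverse (real (Suc n)))"
      unfolding v by simp
    then show ?thesis
      unfolding v_sharp_def INF_less_iff P_sharp_def sensible_I_def by (auto intro: less_imp_le)
  qed
  then obtain p where p: "\<And>n. p n \<in> P_sharp {0..} {0..} (\<lambda>a b. \<phi> (a - b)) (ereal (v + inverse (real (Suc n))))"
    by metis
  have "(\<lambda>n. v + inverse (real (Suc n))) \<longlonglongrightarrow> v"
    using tendsto_add[OF tendsto_const[of v] LIMSEQ_inverse_real_of_nat] by simp
  from P_sharp_subseq_limit[of p, OF p this] show ?thesis by blast
qed

text \<open>With it a bound against a dense set of pure strategies holds against all of them.\<close>

lemma continuous_on_mixed_payoff:
  assumes p: "p \<in> borel_probs {0..}" and fin: "moment_finite p"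
  shows "continuous_on {0..} (\<lambda>b. \<integral>a. \<phi> (a - b) \<partial>p)"
proof (rule continuous_on_sequentiallyI)
  interpret prob_space p by (rule borel_probsD[OF p])
  fix y b assume y: "\<forall>n. y n \<in> {0::real..}" and b: "b \<in> {0..}" and lim: "y \<longlonglongrightarrow> b"
  obtain K where K: "\<And>n. y n \<le> K"
    using convergent_imp_bounded[OF lim]
    by (auto simp: bounded_iff) (metis abs_le_D1)
  show "(\<lambda>n. \<integral>a. \<phi> (a - y n) \<partial>p) \<longlonglongrightarrow> (\<integral>a. \<phi> (a - b) \<partial>p)"
  proof (rule integral_dominated_convergence[where w = "\<lambda>a. C * (2 + a ^ m + K ^ m)"])
    show "integrable p (\<lambda>a. C * (2 + a ^ m + K ^ m))"
      using fin by (simp add: moment_finite_def)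
    show "AE a in p. (\<lambda>n. \<phi> (a - y n)) \<longlonglongrightarrow> \<phi> (a - b)"
      by (intro AE_I2 continuous_on_tendsto_compose[OF continuous] tendsto_intros lim) auto
    show "AE a in p. norm (\<phi> (a - y n)) \<le> C * (2 + a ^ m + K ^ m)" for n
    proof (rule AE_I2)
      fix a assume "a \<in> space p"
      then have "a \<ge> 0" using borel_probsD(3)[OF p] by simp
      then have "norm (\<phi> (a - y n)) \<le> C * (2 + a ^ m + y n ^ m)" using abs_payoff_le y by simp
      also have "\<dots> \<le> C * (2 + a ^ m + K ^ m)"
        using K[of n] y C_nonneg by (intro mult_left_mono add_left_mono power_mono) auto
      finally show "norm (\<phi> (a - y n)) \<le> C * (2 + a ^ m + K ^ m)" .
    qed
  qed (auto intro: borel_measurable_borel_probs[OF p])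
qed

end

section \<open>Value and optimal strategies\<close>

lemma (in odd_growth) v_sharp_real:
  obtains v where "v_sharp {0..} {0..} (\<lambda>a b. \<phi> (a - b)) = ereal v"
  using v_sharp_le v_sharp_ge by (cases "v_sharp {0..} {0..} (\<lambda>a b. \<phi> (a - b))") auto

lemma (in odd_growth) P_sharp_sensible:
  "P_sharp {0..} {0..} (\<lambda>a b. \<phi> (a - b)) (ereal v) \<subseteq> sensible_I {0..} {0..} (\<lambda>a b. \<phi> (a - b))"
  using sensible_if_moment_finite by (auto simp: P_sharp_iff)

lemma (in odd_growth) payoff_sharp_not_sensible:
  assumes "p \<in> borel_probs {0..}" "p \<notin> sensible_I {0..} {0..} (\<lambda>a b. \<phi> (a - b))"
  shows "payoff_sharp {0..} (\<lambda>a b. \<phi> (a - b)) p = \<infinity>"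
  using assms moment_finite_if_sharp_finite sensible_if_moment_finite by blast

context odd_growth
begin

interpretation reversed: odd_growth "\<lambda>s. - \<phi> (- s)" m k C
  by (rule odd_growth_reversed)

text \<open>Replies \<open>b\<close> that keep the payoff above a level \<open>u\<close> are bounded, by coercivity in \<open>b\<close>.
Without this the payoffs in the regret argument would be unbounded.\<close>

lemma payoff_above_bounds_reply:
  assumes "a \<ge> 0" "b \<ge> 0" "a \<le> N" "u < \<phi> (a - b)"
  shows "b \<le> max 1 (offset N - slope * u)"
proof -
  have "b ^ m \<le> offset a - slope * \<phi> (a - b)"
    using reversed.power_le_payoff[of b a] assms by simp
  also have "\<dots> \<le> offset N - slope * u"
  proof (rule diff_mono)
    have "a ^ m \<le> N ^ m" using assms by (intro power_mono) auto
    then show "offset a \<le> offset N"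
      unfolding offset_def using k C_nonneg
      by (intro mult_left_mono add_mono divide_right_mono) auto
    show "slope * u \<le> slope * \<phi> (a - b)" using slope_nonneg assms by (intro mult_left_mono) auto
  qed
  finally have *: "b ^ m \<le> offset N - slope * u" .
  show ?thesis
  proof (cases "b \<le> 1")
    case False
    then have "b \<le> b ^ m" using m by (intro self_le_power) auto
    with * show ?thesis by simp
  qed simp
qed

text \<open>Normalized weights on \<open>F\<close> define a sensible strategy of Player I, so some reply earns more than
\<open>u\<close> against it, which is the response hypothesis of \<open>approachability\<close>. The slack between
\<open>w\<close> and \<open>v\<close> is split in the middle: \<open>u\<close> is the level for the replies, and the averaging
error may use up \<open>u - w\<close>.\<close>

lemma finite_minimax:
  assumes v: "v_sharp {0..} {0..} (\<lambda>a b. \<phi> (a - b)) = ereal v" and w: "w < v"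
    and F: "finite F" "F \<subseteq> {0..}"
  shows "\<exists>q \<in> borel_probs {0..}. moment_finite q \<and> (\<forall>a\<in>F. w \<le> (\<integral>b. \<phi> (a - b) \<partial>q))"
proof -
  define u where "u = (v + w) / 2"
  have u: "u < v" "u - w > 0" using w by (auto simp: u_def field_simps)
  define N where "N = (\<Sum>a\<in>F. a)"
  have N: "a \<le> N" if "a \<in> F" for a
    unfolding N_def using F that by (intro member_le_sum) auto
  have N0: "N \<ge> 0" unfolding N_def using F by (intro sum_nonneg) auto
  \<comment> \<open>By \<open>payoff_above_bounds_reply\<close> every useful reply lies in \<open>{0..L}\<close>.\<close>
  define L where "L = max 1 (offset N - slope * u)"
  have meas: "(\<lambda>a. \<phi> (a - b)) \<in> borel_measurable (borel_on {0..})" for b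
    by (rule measurable_borel_on) measurable
  have "\<exists>n b. n > 0 \<and> (\<forall>s. b s \<in> {0..L}) \<and> (\<forall>a\<in>F. (\<Sum>s<n. \<phi> (a - b s) - u) / real n \<ge> - (u - w))"
  proof (rule approachability[OF F(1)])
    show "\<bar>\<phi> (a - b) - u\<bar> \<le> C * (2 + N ^ m + L ^ m) + \<bar>u\<bar>" if "a \<in> F" "b \<in> {0..L}" for a b
    proof -
      have ab: "a \<ge> 0" "b \<ge> 0" "a \<le> N" "b \<le> L" using that F N by auto
      have "\<bar>\<phi> (a - b)\<bar> \<le> C * (2 + a ^ m + b ^ m)" using abs_payoff_le ab by blast
      also have "\<dots> \<le> C * (2 + N ^ m + L ^ m)"
        using ab C_nonneg by (intro mult_left_mono add_mono power_mono) auto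
      finally show ?thesis by linarith
    qed
    show "\<exists>b\<in>{0..L}. 0 \<le> (\<Sum>i\<in>F. wt i * (\<phi> (i - b) - u))" if wt: "\<And>i. i \<in> F \<Longrightarrow> 0 \<le> wt i" for wt
    proof (cases "sum wt F = 0")
      case True
      then have "\<forall>i\<in>F. wt i = 0" using sum_nonneg_eq_0_iff[OF F(1)] wt by blast
      then show ?thesis by (intro bexI[of _ 0]) (auto simp: L_def)
    next
      case False
      define W where "W = sum wt F"
      have W: "W > 0" using False sum_nonneg[of F wt] wt by (simp add: W_def)
      define f where "f i = (if i \<in> F then wt i / W else 0)" for i
      have f_nonneg: "\<And>i. 0 \<le> f i" using wt W by (auto simp: f_def)
      have f_prob: "(\<integral>\<^sup>+ i. ennreal (f i) \<partial>count_space UNIV) = 1"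
      proof -
        have "(\<integral>\<^sup>+ i. ennreal (f i) \<partial>count_space UNIV) = (\<Sum>i\<in>F. ennreal (f i))"
          using F(1) by (intro nn_integral_count_space'[of F]) (auto simp: f_def)
        also have "\<dots> = ennreal (\<Sum>i\<in>F. f i)" using f_nonneg by (intro sum_ennreal) auto
        also have "(\<Sum>i\<in>F. f i) = 1"
          using W by (simp add: f_def W_def flip: sum_divide_distrib)
        finally show ?thesis by simp
      qed
      define P where "P = embed_pmf f"
      have pmf_P: "pmf P i = f i" for i unfolding P_def by (rule pmf_embed_pmf[OF f_nonneg f_prob])
      have set_P: "set_pmf P \<subseteq> F" by (auto simp: set_pmf_eq pmf_P f_def)
      \<comment> \<open>The probability mass function lives on the whole line; the maximum only moves points outside its support.\<close>
      define p where "p = distr (measure_pmf P) (borel_on {0..}) (\<lambda>x::real. max x 0)"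
      have h: "\<And>x::real. max x 0 \<in> {0..}" and H: "{0::real..} \<in> sets borel" by auto
      note fs = finitely_supported_strategy[where h = "\<lambda>x::real. max x 0", OF H h F(1) set_P, folded p_def]
      have p: "p \<in> borel_probs {0..}" by (rule fs(1))
      have fin: "moment_finite p"
        unfolding moment_finite_def by (rule fs(2)) (rule measurable_borel_on, simp)
      have "ereal u < payoff_sharp {0..} (\<lambda>a b. \<phi> (a - b)) p"
      proof (rule less_le_trans)
        show "ereal u < ereal v" using u by simp
        show "ereal v \<le> payoff_sharp {0..} (\<lambda>a b. \<phi> (a - b)) p"
          unfolding v[symmetric] v_sharp_def
          by (rule INF_lower) (rule sensible_if_moment_finite[OF p fin])
      qed
      then obtain b where b: "b \<ge> 0" "u < (\<integral>a. \<phi> (a - b) \<partial>p)"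
        unfolding payoff_sharp_def less_SUP_iff by (auto simp: payoff_pure_II[OF p fin])
      have "(\<integral>a. \<phi> (a - b) \<partial>p) = (\<Sum>i\<in>F. wt i / W * \<phi> (i - b))"
        unfolding fs(3)[OF meas] using F(2) by (intro sum.cong) (auto simp: pmf_P f_def max_def)
      also have "\<dots> = (\<Sum>i\<in>F. wt i * \<phi> (i - b)) / W"
        by (simp add: sum_divide_distrib)
      finally have "u < (\<Sum>i\<in>F. wt i * \<phi> (i - b)) / W" using b(2) by simp
      then have "u * W < (\<Sum>i\<in>F. wt i * \<phi> (i - b))"
        using W by (simp add: pos_less_divide_eq)
      then have pos: "0 < (\<Sum>i\<in>F. wt i * (\<phi> (i - b) - u))"
        by (simp add: W_def right_diff_distrib sum_subtractf sum_distrib_left mult.commute)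
      have "\<exists>i\<in>F. 0 < wt i * (\<phi> (i - b) - u)"
      proof (rule ccontr)
        assume "\<not> ?thesis"
        then have "(\<Sum>i\<in>F. wt i * (\<phi> (i - b) - u)) \<le> 0" by (intro sum_nonpos) (auto simp: not_less)
        with pos show False by simp
      qed
      then obtain i where i: "i \<in> F" "u < \<phi> (i - b)"
        using wt by (auto simp: zero_less_mult_iff) (meson leD)
      then have "b \<le> L"
        unfolding L_def using payoff_above_bounds_reply[of i b N u] b(1) N F by auto
      with b(1) pos show ?thesis by (intro bexI[of _ b]) auto
    qed
    show "u - w > 0" by (rule u(2))
  qed
  then obtain n b where n: "n > (0::nat)" and b: "\<And>s. b s \<in> {0..L}"
    and avg: "\<And>a. a \<in> F \<Longrightarrow> (\<Sum>s<n. \<phi> (a - b s) - u) / real n \<ge> - (u - w)"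
    by blast
  have ne: "{..<n} \<noteq> {}" "finite {..<n}" using n by auto
  have b0: "\<And>s. b s \<in> {0..}" using b by auto
  define q where "q = distr (measure_pmf (pmf_of_set {..<n})) (borel_on {0..}) b"
  have sub: "set_pmf (pmf_of_set {..<n}) \<subseteq> {..<n}" using ne by (simp add: set_pmf_of_set)
  have H: "{0::real..} \<in> sets borel" by auto
  note fs = finitely_supported_strategy[where h = b, OF H b0 ne(2) sub, folded q_def]
  show ?thesis
  proof (intro bexI conjI ballI)
    show "q \<in> borel_probs {0..}" by (rule fs(1))
    show "moment_finite q"
      unfolding moment_finite_def by (rule fs(2)) (rule measurable_borel_on, simp)
    fix a assume a: "a \<in> F"
    have "(\<lambda>b. \<phi> (a - b)) \<in> borel_measurable (borel_on {0..})"
      using measurable_payoff_II[of a] a F by auto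
    then have "(\<integral>b. \<phi> (a - b) \<partial>q) = (\<Sum>s<n. \<phi> (a - b s)) / real n"
      using ne by (simp add: fs(3) sum_divide_distrib)
    moreover have "(\<Sum>s<n. \<phi> (a - b s) - u) / real n = (\<Sum>s<n. \<phi> (a - b s)) / real n - u"
      using n by (simp add: sum_subtractf field_simps)
    ultimately show "w \<le> (\<integral>b. \<phi> (a - b) \<partial>q)" using avg[OF a] by simp
  qed
qed

text \<open>Strategies that are good against the first \<open>n\<close> points of a countable dense set have a weakly
convergent subsequence. For Player II the payoff is upper semicontinuous under weak limits, so the limit is
good against each of the points, and by continuity in \<open>a\<close> against all actions.\<close>

lemma optimal_II_exists:
  assumes v: "v_sharp {0..} {0..} (\<lambda>a b. \<phi> (a - b)) = ereal v"
  shows "\<exists>q \<in> borel_probs {0..}. moment_finite q \<and> (\<forall>a\<ge>0. v \<le> (\<integral>b. \<phi> (a - b) \<partial>q))"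
proof -
  obtain D :: "real set" where D: "countable D" "D \<subseteq> {0..}" "{0..} \<subseteq> closure D"
    using separable by blast
  have Dne: "D \<noteq> {}" using D(3) by auto
  define d where "d = from_nat_into D"
  have d: "d j \<in> D" "d j \<ge> 0" for j
    using from_nat_into[OF Dne, of j] D(2) by (auto simp: d_def)
  define w where "w n = v - inverse (real (Suc n))" for n
  have w: "w n < v" "v - 1 \<le> w n" for n
    by (auto simp: w_def field_simps)
  have w_lim: "w \<longlonglongrightarrow> v"
    unfolding w_def using tendsto_diff[OF tendsto_const[of v] LIMSEQ_inverse_real_of_nat] by simp
  have "\<exists>q. q \<in> borel_probs {0..} \<and> moment_finite q \<and> (\<forall>j\<le>n. w n \<le> (\<integral>b. \<phi> (d j - b) \<partial>q))" for n
    using finite_minimax[OF v w(1), of "d ` {..n}" n] d(2) by auto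
  then obtain q where q: "\<And>n. q n \<in> borel_probs {0..}" "\<And>n. moment_finite (q n)"
    "\<And>n j. j \<le> n \<Longrightarrow> w n \<le> (\<integral>b. \<phi> (d j - b) \<partial>q n)"
    by metis
  have fin: "reversed.moment_finite (q n)" for n
    using q(2) by (simp add: moment_finite_def reversed.moment_finite_def)
  have "(\<integral>b. - \<phi> (- (b - d 0)) \<partial>q n) \<le> 1 - v" for n
    using q(3)[of 0 n] w(2)[of n] by simp
  then obtain r l where r: "strict_mono (r :: nat \<Rightarrow> nat)" and l: "l \<in> borel_probs {0..}"
    and conv: "weak_conv_m (\<lambda>n. on_line (q (r n))) (on_line l)"
    using reversed.bounded_payoff_weak_limit[of q "d 0" "1 - v", OF q(1) fin d(2)] by blast
  have lim: "reversed.moment_finite l \<and> (\<integral>b. - \<phi> (- (b - d j)) \<partial>l) \<le> - v" for j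
  proof (rule reversed.payoff_weak_limit[of "\<lambda>n. q (r n)" l "d j" "\<lambda>n. - w (r n)" "- v", OF q(1) fin l conv d(2)])
    show "(\<lambda>n. - w (r n)) \<longlonglongrightarrow> - v"
      using LIMSEQ_subseq_LIMSEQ[OF w_lim r] by (simp add: o_def tendsto_minus)
    show "\<forall>\<^sub>F n in sequentially. (\<integral>b. - \<phi> (- (b - d j)) \<partial>q (r n)) \<le> - w (r n)"
      using eventually_ge_at_top[of j]
    proof eventually_elim
      case (elim n)
      then have "j \<le> r n" using seq_suble[OF r, of n] by simp
      from q(3)[OF this] show ?case by simp
    qed
  qed
  have cont: "continuous_on {0..} (\<lambda>a. \<integral>b. \<phi> (a - b) \<partial>l)"
    using continuous_on_minus[OF reversed.continuous_on_mixed_payoff[OF l]] lim by simp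
  have "closure D = {0..}" using D closure_minimal[of D "{0..}"] by auto
  have "v \<le> (\<integral>b. \<phi> (a - b) \<partial>l)" if "a \<ge> 0" for a
  proof (rule continuous_ge_on_closure[of D "\<lambda>a. \<integral>b. \<phi> (a - b) \<partial>l" a v])
    show "v \<le> (\<integral>b. \<phi> (x - b) \<partial>l)" if "x \<in> D" for x
    proof -
      obtain j where "x = d j"
        using from_nat_into_surj[OF D(1) \<open>x \<in> D\<close>] by (auto simp: d_def)
      then show ?thesis using lim[of j] by simp
    qed
  qed (use cont \<open>closure D = {0..}\<close> that in auto)
  moreover have "moment_finite l" using lim by (simp add: moment_finite_def reversed.moment_finite_def)
  ultimately show ?thesis using l by blast
qed

lemma P_flat_reversed:
  "P_flat {0..} {0..} (\<lambda>a b. \<phi> (a - b)) (ereal v)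
    = P_sharp {0..} {0..} (\<lambda>b a. - \<phi> (- (b - a))) (ereal (- v))"
  using P_sharp_reversed[OF payoff_defined_pure_I, of "ereal v"] by simp

lemma P_flat_sensible:
  "P_flat {0..} {0..} (\<lambda>a b. \<phi> (a - b)) (ereal v) \<subseteq> sensible_II {0..} {0..} (\<lambda>a b. \<phi> (a - b))"
  using reversed.P_sharp_sensible[of "- v"] sensible_I_reversed by (simp add: P_flat_reversed)

text \<open>Weak duality is used only against one optimal strategy of Player I, whose payoff is defined against every
strategy of Player II.\<close>

lemma v_flat_eq_v_sharp:
  assumes v: "v_sharp {0..} {0..} (\<lambda>a b. \<phi> (a - b)) = ereal v"
  shows "v_flat {0..} {0..} (\<lambda>a b. \<phi> (a - b)) = ereal v"
proof (rule antisym)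
  let ?c = "\<lambda>a b. \<phi> (a - b)"
  obtain q where q: "q \<in> borel_probs {0..}" "moment_finite q" "\<And>a. a \<ge> 0 \<Longrightarrow> v \<le> (\<integral>b. \<phi> (a - b) \<partial>q)"
    using optimal_II_exists[OF v] by blast
  have fin: "reversed.moment_finite q"
    using q(2) by (simp add: moment_finite_def reversed.moment_finite_def)
  have int: "integrable q (\<lambda>b. \<phi> (a - b))" if "a \<ge> 0" for a
    using reversed.integrable_payoff[OF q(1) fin that] by simp
  have "ereal v \<le> payoff_flat {0..} ?c q"
    unfolding payoff_flat_def using q int by (intro INF_greatest) (auto simp: payoff_dirac_I)
  then have "q \<in> P_flat {0..} {0..} ?c (ereal v)" using q by (simp add: P_flat_def)
  then have "q \<in> sensible_II {0..} {0..} ?c" using P_flat_sensible by blast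
  then show "ereal v \<le> v_flat {0..} {0..} ?c"
    unfolding v_flat_def using \<open>ereal v \<le> payoff_flat {0..} ?c q\<close> by (rule SUP_upper2)
  obtain p where p: "p \<in> P_sharp {0..} {0..} ?c (ereal v)" using P_sharp_nonempty[OF v] by blast
  then have ps: "p \<in> sensible_I {0..} {0..} ?c" "p \<in> borel_probs {0..}"
    using P_sharp_sensible by (auto simp: P_sharp_def)
  show "v_flat {0..} {0..} ?c \<le> ereal v"
    unfolding v_flat_def
  proof (rule SUP_least, rule ccontr)
    fix q' assume q': "q' \<in> sensible_II {0..} {0..} ?c" and "\<not> payoff_flat {0..} ?c q' \<le> ereal v"
    then obtain r where r: "v < r" "ereal r < payoff_flat {0..} ?c q'"
      using ereal_dense2[of "ereal v" "payoff_flat {0..} ?c q'"] by (auto simp: not_le)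
    have q'': "q' \<in> borel_probs {0..}" using q' by (simp add: sensible_II_def)
    have "ereal r \<le> payoff ?c p q'"
    proof (rule payoff_ge_of_dirac[OF ps(2) q''])
      show "ereal r \<le> payoff ?c (dirac {0..} a) q'" if "a \<in> {0..}" for a
        using r(2) INF_lower[OF that, of "\<lambda>a. payoff ?c (dirac {0..} a) q'"]
        unfolding payoff_flat_def by (meson less_imp_le order_trans)
    qed
    moreover have "payoff ?c p q' \<le> ereal v"
    proof (rule payoff_le_of_dirac[OF ps(2) q''])
      show "payoff_defined ?c p q'" using ps(1) q'' by (simp add: sensible_I_def)
      show "payoff ?c p (dirac {0..} b) \<le> ereal v" if "b \<in> {0..}" for b
        using p that by (auto simp: P_sharp_def payoff_sharp_def SUP_le_iff)
    qed
    ultimately show False using r(1) by (metis ereal_less_eq(3) leD order_trans)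
  qed
qed

lemma convex_compact_nonempty_P_flat:
  assumes v: "v_sharp {0..} {0..} (\<lambda>a b. \<phi> (a - b)) = ereal v"
  shows "P_flat {0..} {0..} (\<lambda>a b. \<phi> (a - b)) (ereal v) \<noteq> {}"
    and "convex_measures (P_flat {0..} {0..} (\<lambda>a b. \<phi> (a - b)) (ereal v))"
    and "compactin (weak_topology {0..}) (P_flat {0..} {0..} (\<lambda>a b. \<phi> (a - b)) (ereal v))"
proof -
  have "v_sharp {0..} {0..} (\<lambda>b a. - \<phi> (- (b - a))) = ereal (- v)"
    using v_sharp_reversed v_flat_eq_v_sharp[OF v] by simp
  then show "P_flat {0..} {0..} (\<lambda>a b. \<phi> (a - b)) (ereal v) \<noteq> {}"
    unfolding P_flat_reversed by (rule reversed.P_sharp_nonempty)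
  show "convex_measures (P_flat {0..} {0..} (\<lambda>a b. \<phi> (a - b)) (ereal v))"
    unfolding P_flat_reversed by (rule reversed.convex_measures_P_sharp)
  show "compactin (weak_topology {0..}) (P_flat {0..} {0..} (\<lambda>a b. \<phi> (a - b)) (ereal v))"
    unfolding P_flat_reversed by (rule reversed.compactin_P_sharp)
qed

lemma payoff_flat_not_sensible:
  assumes "q \<in> borel_probs {0..}" "q \<notin> sensible_II {0..} {0..} (\<lambda>a b. \<phi> (a - b))"
  shows "payoff_flat {0..} (\<lambda>a b. \<phi> (a - b)) q = - \<infinity>"
proof -
  have "payoff_sharp {0..} (\<lambda>b a. - \<phi> (- (b - a))) q = \<infinity>"
    using reversed.payoff_sharp_not_sensible[OF assms(1)] assms(2) sensible_I_reversed by simp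
  then show ?thesis
    using payoff_sharp_reversed[OF assms(1) payoff_defined_pure_I[OF _ assms(1)]]
    by (cases "payoff_flat {0..} (\<lambda>a b. \<phi> (a - b)) q") simp_all
qed

lemma inf_compact_payoff: "inf_compact_on {0..} (\<lambda>a. ereal (\<phi> (a - 0)))"
  unfolding inf_compact_on_def
proof
  fix l :: real
  have "closed ({s. \<phi> s \<le> l} \<inter> {0..})"
    using closed_Collect_le[OF continuous continuous_on_const, of l] by (intro closed_Int) auto
  moreover have "{s. \<phi> s \<le> l} \<inter> {0..} \<subseteq> {0..max 1 (slope * l + offset 0)}"
  proof
    fix s assume s: "s \<in> {s. \<phi> s \<le> l} \<inter> {0..}"
    have "s ^ m \<le> slope * \<phi> s + offset 0" using power_le_payoff[of s 0] s by simp
    also have "\<dots> \<le> slope * l + offset 0" using s slope_nonneg by (simp add: mult_left_mono)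
    finally have "s ^ m \<le> slope * l + offset 0" .
    moreover have "s \<le> s ^ m" if "s > 1" using that m by (intro self_le_power) auto
    ultimately show "s \<in> {0..max 1 (slope * l + offset 0)}" using s by (cases "s > 1") auto
  qed
  ultimately have "compact ({s. \<phi> s \<le> l} \<inter> {0..})"
    using bounded_subset[OF bounded_closed_interval] compact_eq_bounded_closed by blast
  then show "compact {s \<in> {0..}. ereal (\<phi> (s - 0)) \<le> ereal l}"
    by (simp add: Int_def conj_commute)
qed

lemma lsc_payoff: "lsc_on {0..} (\<lambda>a. ereal (\<phi> (a - b)))"
  unfolding lsc_on_def
proof
  fix x :: real
  have lim: "((\<lambda>a. ereal (\<phi> (a - b))) \<longlongrightarrow> ereal (\<phi> (x - b))) (at x within {0..})"
    by (intro tendsto_intros continuous_on_tendsto_compose[OF continuous]) auto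
  show "ereal (\<phi> (x - b)) \<le> Liminf (at x within {0..}) (\<lambda>a. ereal (\<phi> (a - b)))"
    using lim_imp_Liminf[OF _ lim] by (cases "at x within {0..} = bot") auto
qed

lemma zero_sum_game_difference: "zero_sum_game {0..} {0..} (\<lambda>a b. \<phi> (a - b))"
  unfolding zero_sum_game_def bounded_below_I_def bounded_above_II_def
proof (intro conjI ballI)
  show "(\<lambda>(a, b). \<phi> (a - b)) \<in> borel_measurable (borel_on ({0..} \<times> {0..}))"
    unfolding borel_on_def by (rule measurable_restrict_space1[OF measurable_difference[OF continuous]])
  show "bdd_below ((\<lambda>a. \<phi> (a - b)) ` {0..})" if "b \<in> {0..}" for b
    using payoff_lower that by (intro bdd_belowI2[of _ "- (C * (1 + b ^ m))"]) auto
  show "bdd_above ((\<lambda>b. \<phi> (a - b)) ` {0..})" if "a \<in> {0..}" for a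
    using payoff_upper that by (intro bdd_aboveI2[of _ _ "C * (1 + a ^ m)"]) auto
qed auto

end

section \<open>Growth of polynomials\<close>

text \<open>A lower power is at most \<open>s ^ M / T + T ^ M\<close>: the first term dominates for \<open>s \<ge> T\<close>, the second
for \<open>s \<le> T\<close>. With \<open>T\<close> large the first terms together use up at most half of the leading
coefficient.\<close>

lemma polynomial_growth:
  fixes \<beta> :: "nat \<Rightarrow> real"
  assumes M: "M \<ge> 1" and lead: "\<beta> M > 0"
  shows "\<exists>k>0. \<exists>C\<ge>0. \<forall>s\<ge>0. k * s ^ M - C \<le> (\<Sum>n=0..M. \<beta> n * s ^ n)
    \<and> (\<Sum>n=0..M. \<beta> n * s ^ n) \<le> C * (1 + s ^ M)"
proof -
  define S where "S = (\<Sum>n<M. \<bar>\<beta> n\<bar>)"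
  have S: "S \<ge> 0" by (simp add: S_def sum_nonneg)
  define T where "T = max 1 (2 * S / \<beta> M)"
  have T: "T \<ge> 1" "S \<le> \<beta> M / 2 * T" using lead by (auto simp: T_def max_def field_simps)
  have power_le: "s ^ n \<le> s ^ M / T + T ^ M" if "n < M" "s \<ge> 0" for n and s :: real
  proof (cases "s \<ge> T")
    case True
    have "T \<le> s ^ (M - n)" using True T that self_le_power[of s "M - n"] by simp
    then have "s ^ n * T \<le> s ^ n * s ^ (M - n)" using that by (intro mult_left_mono) auto
    also have "\<dots> = s ^ M" using that by (simp flip: power_add)
    finally have "s ^ n \<le> s ^ M / T" using T by (simp add: field_simps)
    moreover have "0 \<le> T ^ M" using T by simp
    ultimately show ?thesis by simp
  next
    case False
    have "s ^ n \<le> T ^ n" using False that by (intro power_mono) auto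
    also have "\<dots> \<le> T ^ M" using that T by (intro power_increasing) auto
    moreover have "0 \<le> s ^ M / T" using that T by simp
    ultimately show ?thesis by simp
  qed
  have split: "(\<Sum>n=0..M. \<beta> n * s ^ n) = (\<Sum>n<M. \<beta> n * s ^ n) + \<beta> M * s ^ M" for s
    by (simp add: atLeast0AtMost flip: lessThan_Suc_atMost)
  have low: "\<bar>\<Sum>n<M. \<beta> n * s ^ n\<bar> \<le> \<beta> M / 2 * s ^ M + S * T ^ M" if s: "s \<ge> 0" for s
  proof -
    have "\<bar>\<Sum>n<M. \<beta> n * s ^ n\<bar> \<le> (\<Sum>n<M. \<bar>\<beta> n * s ^ n\<bar>)" by (rule sum_abs)
    also have "\<dots> \<le> (\<Sum>n<M. \<bar>\<beta> n\<bar> * (s ^ M / T + T ^ M))"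
    proof (rule sum_mono)
      fix n assume "n \<in> {..<M}"
      then have "\<bar>\<beta> n\<bar> * s ^ n \<le> \<bar>\<beta> n\<bar> * (s ^ M / T + T ^ M)"
        using power_le s by (intro mult_left_mono) auto
      then show "\<bar>\<beta> n * s ^ n\<bar> \<le> \<bar>\<beta> n\<bar> * (s ^ M / T + T ^ M)"
        using s by (simp add: abs_mult)
    qed
    also have "\<dots> = S * (s ^ M / T + T ^ M)" by (simp add: S_def sum_distrib_right)
    also have "\<dots> = S / T * s ^ M + S * T ^ M" by (simp add: algebra_simps)
    also have "S / T * s ^ M \<le> \<beta> M / 2 * s ^ M"
      using T s by (intro mult_right_mono) (simp_all add: field_simps)
    finally show ?thesis by simp
  qed
  define C where "C = S * T ^ M + 2 * \<beta> M"
  have ST: "0 \<le> S * T ^ M" using S T by simp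
  have "\<beta> M / 2 * s ^ M - C \<le> (\<Sum>n=0..M. \<beta> n * s ^ n) \<and> (\<Sum>n=0..M. \<beta> n * s ^ n) \<le> C * (1 + s ^ M)"
    if s: "s \<ge> 0" for s
  proof
    have sM: "0 \<le> s ^ M" using s by simp
    show "\<beta> M / 2 * s ^ M - C \<le> (\<Sum>n=0..M. \<beta> n * s ^ n)"
      unfolding split using low[OF s] lead by (simp add: C_def abs_le_iff)
    have "C * (1 + s ^ M) = S * T ^ M + 2 * \<beta> M + S * T ^ M * s ^ M + 2 * (\<beta> M * s ^ M)"
      by (simp add: C_def algebra_simps)
    moreover have "0 \<le> S * T ^ M * s ^ M" "0 \<le> \<beta> M * s ^ M"
      using ST sM lead by simp_all
    ultimately show "(\<Sum>n=0..M. \<beta> n * s ^ n) \<le> C * (1 + s ^ M)"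
      unfolding split using low[OF s] lead ST by (simp add: abs_le_iff)
  qed
  moreover have "\<beta> M / 2 > 0" "C \<ge> 0" using lead ST by (auto simp: C_def)
  ultimately show ?thesis by blast
qed

lemma polynomial_minus:
  fixes \<alpha> :: "nat \<Rightarrow> real"
  shows "(\<Sum>n=0..M. \<alpha> n * (- s) ^ n) = (\<Sum>n=0..M. (\<alpha> n * (- 1) ^ n) * s ^ n)"
  by (intro sum.cong refl) (simp add: power_minus[of s])

lemma odd_polynomial_growth:
  fixes \<alpha> :: "nat \<Rightarrow> real"
  assumes M: "M \<ge> 1" and odd: "odd M" and lead: "\<alpha> M > 0"
  obtains k C where "odd_growth (\<lambda>s. \<Sum>n=0..M. \<alpha> n * s ^ n) M k C"
proof -
  obtain k1 C1 where 1: "k1 > 0" "C1 \<ge> 0"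
    "\<And>s. s \<ge> 0 \<Longrightarrow> k1 * s ^ M - C1 \<le> (\<Sum>n=0..M. \<alpha> n * s ^ n)"
    "\<And>s. s \<ge> 0 \<Longrightarrow> (\<Sum>n=0..M. \<alpha> n * s ^ n) \<le> C1 * (1 + s ^ M)"
    using polynomial_growth[of M \<alpha>, OF M lead] by blast
  have "- (\<alpha> M * (- 1) ^ M) > 0" using lead odd by simp
  then obtain k2 C2 where 2: "k2 > 0" "C2 \<ge> 0"
    "\<And>s. s \<ge> 0 \<Longrightarrow> k2 * s ^ M - C2 \<le> (\<Sum>n=0..M. - (\<alpha> n * (- 1) ^ n) * s ^ n)"
    "\<And>s. s \<ge> 0 \<Longrightarrow> (\<Sum>n=0..M. - (\<alpha> n * (- 1) ^ n) * s ^ n) \<le> C2 * (1 + s ^ M)"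
    using polynomial_growth[OF M, of "\<lambda>n. - (\<alpha> n * (- 1) ^ n)"] by blast
  have neg: "- (\<Sum>n=0..M. \<alpha> n * (- s) ^ n) = (\<Sum>n=0..M. - (\<alpha> n * (- 1) ^ n) * s ^ n)" for s
    by (simp add: polynomial_minus sum_negf)
  define k C where "k = min k1 k2" and "C = max C1 C2"
  have kC: "k * s ^ M - C \<le> k1 * s ^ M - C1" "k * s ^ M - C \<le> k2 * s ^ M - C2"
      "C1 * (1 + s ^ M) \<le> C * (1 + s ^ M)" "C2 * (1 + s ^ M) \<le> C * (1 + s ^ M)" if "s \<ge> 0" for s
    using that unfolding k_def C_def by (intro diff_mono mult_right_mono; simp)+
  have "odd_growth (\<lambda>s. \<Sum>n=0..M. \<alpha> n * s ^ n) M k C"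
  proof
    show "continuous_on UNIV (\<lambda>s. \<Sum>n=0..M. \<alpha> n * s ^ n)" by (intro continuous_intros)
    show "1 \<le> M" "0 < k" using M 1 2 by (auto simp: k_def)
    fix s :: real assume s: "s \<ge> 0"
    show "k * s ^ M - C \<le> (\<Sum>n=0..M. \<alpha> n * s ^ n)" using 1(3)[OF s] kC(1)[OF s] by linarith
    show "(\<Sum>n=0..M. \<alpha> n * s ^ n) \<le> C * (1 + s ^ M)" using 1(4)[OF s] kC(3)[OF s] by linarith
    show "k * s ^ M - C \<le> - (\<Sum>n=0..M. \<alpha> n * (- s) ^ n)" unfolding neg using 2(3)[OF s] kC(2)[OF s] by linarith
    show "- (\<Sum>n=0..M. \<alpha> n * (- s) ^ n) \<le> C * (1 + s ^ M)" unfolding neg using 2(4)[OF s] kC(4)[OF s] by linarith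
  qed
  then show thesis by (rule that)
qed

lemma polynomial_at_top:
  fixes \<beta> :: "nat \<Rightarrow> real"
  assumes M: "M \<ge> 1" and lead: "\<beta> M > 0"
  shows "filterlim (\<lambda>s. \<Sum>n=0..M. \<beta> n * s ^ n) at_top at_top"
proof -
  obtain k C where k: "k > 0" and "C \<ge> 0"
    and ge: "\<And>s. s \<ge> 0 \<Longrightarrow> k * s ^ M - C \<le> (\<Sum>n=0..M. \<beta> n * s ^ n)"
    and "\<And>s. s \<ge> 0 \<Longrightarrow> (\<Sum>n=0..M. \<beta> n * s ^ n) \<le> C * (1 + s ^ M)"
    using polynomial_growth[of M \<beta>, OF M lead] by blast
  have "filterlim (\<lambda>s::real. s ^ M) at_top at_top"
    using M by (intro filterlim_pow_at_top filterlim_ident) auto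
  then have "filterlim (\<lambda>s. - C + k * s ^ M) at_top at_top"
    using k by (intro filterlim_tendsto_add_at_top[OF tendsto_const]
        filterlim_tendsto_pos_mult_at_top[OF tendsto_const])
  then show ?thesis
  proof (rule filterlim_at_top_mono)
    show "\<forall>\<^sub>F s in at_top. - C + k * s ^ M \<le> (\<Sum>n=0..M. \<beta> n * s ^ n)"
      using eventually_ge_at_top[of 0] by eventually_elim (use ge in auto)
  qed
qed

lemma polynomial_nonconstant_on_interval:
  fixes \<alpha> :: "nat \<Rightarrow> real"
  assumes M: "M \<ge> 1" and lead: "\<alpha> M \<noteq> 0" and xy: "x < y"
  shows "\<exists>s\<in>{x..y}. (\<Sum>n=0..M. \<alpha> n * s ^ n) \<noteq> K"
proof (rule ccontr)
  define \<gamma> where "\<gamma> = \<alpha>(0 := \<alpha> 0 - K)"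
  have eq: "(\<Sum>n=0..M. \<gamma> n * s ^ n) = (\<Sum>n=0..M. \<alpha> n * s ^ n) - K" for s
    by (simp add: \<gamma>_def sum.atLeast_Suc_atMost)
  have "finite {s. (\<Sum>n\<le>M. \<gamma> n * s ^ n) = 0}"
    by (rule polyfun_roots_finite[of _ M]) (use M lead in \<open>auto simp: \<gamma>_def\<close>)
  moreover assume "\<not> ?thesis"
  then have "{x..y} \<subseteq> {s. (\<Sum>n\<le>M. \<gamma> n * s ^ n) = 0}"
    using eq by (auto simp: atLeast0AtMost)
  ultimately show False using xy finite_subset infinite_Icc by blast
qed

lemma polynomial_derivative_at_0:
  fixes \<alpha> :: "nat \<Rightarrow> real"
  assumes "M \<ge> 1"
  shows "((\<lambda>s. \<Sum>n=0..M. \<alpha> n * s ^ n) has_real_derivative \<alpha> 1) (at 0)"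
proof -
  have "((\<lambda>s. \<Sum>n=0..M. \<alpha> n * s ^ n) has_real_derivative (\<Sum>n=0..M. \<alpha> n * (real n * 0 ^ (n - 1)))) (at 0)"
    by (rule DERIV_sum) (auto intro!: derivative_eq_intros)
  moreover have "(\<Sum>n=0..M. \<alpha> n * (real n * 0 ^ (n - 1))) = (\<Sum>n=0..M. if n = 1 then \<alpha> 1 else 0)"
    by (intro sum.cong refl) (auto simp: power_0_left)
  ultimately show ?thesis using assms by (simp add: sum.delta)
qed

section \<open>Pure solutions\<close>

text \<open>At a pure saddle point \<open>\<phi> (a - b)\<close> is the maximum of \<open>\<phi>\<close> on \<open>{..a}\<close> and its minimum
on \<open>{- b..}\<close>, so \<open>\<phi>\<close> is constant on the intersection \<open>{- b..a}\<close>.\<close>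

lemma (in odd_growth) no_pure_solution:
  assumes nonconst: "\<And>x y K. x < y \<Longrightarrow> \<exists>s\<in>{x..y}. \<phi> s \<noteq> K"
    and deriv: "(\<phi> has_real_derivative d) (at 0)" "d < 0"
  shows "\<not> is_pure_solution {0..} {0..} (\<lambda>a b. \<phi> (a - b)) p q"
proof
  assume "is_pure_solution {0..} {0..} (\<lambda>a b. \<phi> (a - b)) p q"
  then obtain a b where ab: "a \<ge> 0" "b \<ge> 0"
    and sol: "is_solution {0..} {0..} (\<lambda>a b. \<phi> (a - b)) (dirac {0..} a) (dirac {0..} b)"
    unfolding is_pure_solution_def by auto
  have saddle: "\<phi> (a - b') \<le> \<phi> (a - b) \<and> \<phi> (a - b) \<le> \<phi> (a' - b)" if "a' \<ge> 0" "b' \<ge> 0" for a' b'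
  proof -
    have "dirac {0..} a' \<in> borel_probs {0..}" "dirac {0..} b' \<in> borel_probs {0..}"
      using that by (auto intro: dirac_in_borel_probs)
    with sol have "payoff (\<lambda>a b. \<phi> (a - b)) (dirac {0..} a) (dirac {0..} b')
          \<le> payoff (\<lambda>a b. \<phi> (a - b)) (dirac {0..} a) (dirac {0..} b) \<and>
        payoff (\<lambda>a b. \<phi> (a - b)) (dirac {0..} a) (dirac {0..} b)
          \<le> payoff (\<lambda>a b. \<phi> (a - b)) (dirac {0..} a') (dirac {0..} b)"
      unfolding is_solution_def by blast
    then show ?thesis using ab that by (simp add: payoff_pure_pure)
  qed
  have "a = 0 \<and> b = 0"
  proof (rule ccontr)
    assume "\<not> (a = 0 \<and> b = 0)"
    then have "- b < a" using ab by auto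
    then obtain s where s: "s \<in> {- b..a}" "\<phi> s \<noteq> \<phi> (a - b)" using nonconst by blast
    then show False using saddle[of "s + b" "a - s"] by simp
  qed
  then have min: "\<phi> 0 \<le> \<phi> h" if "h \<ge> 0" for h using saddle[OF that, of 0] by simp
  obtain e where e: "e > 0" "\<And>h. 0 < h \<Longrightarrow> h < e \<Longrightarrow> \<phi> (0 + h) < \<phi> 0"
    using DERIV_neg_dec_right[OF deriv] by blast
  show False using e(2)[of "e / 2"] min[of "e / 2"] e(1) by simp
qed

section \<open>Games without a finite value\<close>

context odd_growth
begin

interpretation reversed: odd_growth "\<lambda>s. - \<phi> (- s)" m k C
  by (rule odd_growth_reversed)

text \<open>If the moment of \<open>p\<close> is infinite, every section of the payoff has infinite positive part in
\<open>a\<close> and infinite negative part in \<open>b\<close>. So the strategy itself, played by both sides, shows that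
it is not sensible.\<close>

lemma not_payoff_defined_diagonal:
  assumes p: "p \<in> borel_probs {0..}" and inf: "\<not> moment_finite p"
  shows "\<not> payoff_defined (\<lambda>a b. \<phi> (a - b)) p p"
proof -
  interpret prob_space p by (rule borel_probsD[OF p])
  have "gain (\<lambda>b a. \<phi> (a - b)) p p = (\<integral>\<^sup>+ b. \<infinity> \<partial>p)"
    unfolding gain_def using moment_finite_if_nn_integral_finite[OF p] inf borel_probsD(3)[OF p]
    by (intro nn_integral_cong) auto
  then have "gain (\<lambda>a b. \<phi> (a - b)) p p = \<infinity>"
    using gain_swap[OF p p] by (simp add: emeasure_space_1)
  moreover have "\<not> reversed.moment_finite p"
    using inf by (simp add: moment_finite_def reversed.moment_finite_def)
  then have "gain (\<lambda>a b. - \<phi> (a - b)) p p = (\<integral>\<^sup>+ a. \<infinity> \<partial>p)"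
    unfolding gain_def using reversed.moment_finite_if_nn_integral_finite[OF p] borel_probsD(3)[OF p]
    by (intro nn_integral_cong) auto
  ultimately show ?thesis
    by (simp add: payoff_defined_iff_gain emeasure_space_1)
qed

end

text \<open>The bound \<open>H\<close> controls the gains uniformly in \<open>a\<close>. As \<open>a\<close> runs through the naturals, the
losses tend to infinity pointwise, hence in the mean by Fatou's lemma.\<close>

lemma payoff_flat_eq_minus_infinity:
  fixes \<phi> H :: "real \<Rightarrow> real"
  assumes cont: "continuous_on UNIV \<phi>" and lim: "filterlim (\<lambda>s. - \<phi> s) at_top at_top"
    and q: "q \<in> borel_probs {0..}"
    and H: "\<And>a b. a \<ge> 0 \<Longrightarrow> b \<ge> 0 \<Longrightarrow> \<phi> (a - b) \<le> H b" "(\<integral>\<^sup>+ b. ennreal (H b) \<partial>q) \<noteq> \<infinity>"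
  shows "payoff_flat {0..} (\<lambda>a b. \<phi> (a - b)) q = - \<infinity>"
proof (rule ccontr)
  let ?c = "\<lambda>a b. \<phi> (a - b)"
  interpret measurable_game "{0..}" "{0..}" ?c
    by (rule measurable_game_difference[OF cont])
  interpret opp: measurable_game "{0..}" "{0..}" "\<lambda>a b. - ?c a b"
    by (rule measurable_game_opposite)
  interpret q: prob_space q by (rule borel_probsD[OF q])
  assume "payoff_flat {0..} ?c q \<noteq> - \<infinity>"
  then obtain r where r: "ereal r \<le> payoff_flat {0..} ?c q"
    by (cases "payoff_flat {0..} ?c q") auto
  let ?K = "(\<integral>\<^sup>+ b. ennreal (H b) \<partial>q) + ennreal (- r)"
  have bound: "(\<integral>\<^sup>+ b. ennreal (- \<phi> (real n - b)) \<partial>q) \<le> ?K" for n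
  proof -
    have "ereal r \<le> payoff ?c (dirac {0..} (real n)) q"
      using r INF_lower[of "real n" "{0..}" "\<lambda>a. payoff ?c (dirac {0..} a) q"]
      unfolding payoff_flat_def by (auto intro: order_trans)
    then have "(\<integral>\<^sup>+ b. ennreal (- \<phi> (real n - b)) \<partial>q) + ennreal r
        \<le> (\<integral>\<^sup>+ b. ennreal (\<phi> (real n - b)) \<partial>q) + ennreal (- r)"
      by (simp add: payoff_ge_iff_gain gain_dirac_I[OF _ q] opp.gain_dirac_I[OF _ q])
    also have "\<dots> \<le> ?K"
      using H(1) borel_probsD(3)[OF q] by (intro add_right_mono nn_integral_mono ennreal_leI) auto
    finally show ?thesis by (rule order_trans[rotated]) simp
  qed
  have "liminf (\<lambda>n. ennreal (- \<phi> (real n - b))) = \<infinity>" for b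
  proof (rule lim_imp_Liminf)
    have "filterlim (\<lambda>n. - b + real n) at_top sequentially"
      by (rule filterlim_tendsto_add_at_top[OF tendsto_const filterlim_real_sequentially])
    then have "filterlim (\<lambda>n. - \<phi> (real n - b)) at_top sequentially"
      using filterlim_compose[OF lim] by simp
    then show "(\<lambda>n. ennreal (- \<phi> (real n - b))) \<longlonglongrightarrow> \<infinity>"
      by (simp add: ennreal_tendsto_top_eq_at_top)
  qed simp
  then have "(\<integral>\<^sup>+ b. \<infinity> \<partial>q) = (\<integral>\<^sup>+ b. liminf (\<lambda>n. ennreal (- \<phi> (real n - b))) \<partial>q)"
    by simp
  also have "\<dots> \<le> liminf (\<lambda>n. \<integral>\<^sup>+ b. ennreal (- \<phi> (real n - b)) \<partial>q)"
  proof (rule nn_integral_liminf)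
    show "(\<lambda>b. ennreal (- \<phi> (real n - b))) \<in> borel_measurable q" for n
      using measurable_borel_probs[OF q opp.measurable_payoff_II[of "real n"]] by simp
  qed
  also have "\<dots> \<le> ?K"
    using bound by (intro Liminf_le) auto
  finally have "?K = \<infinity>" by (simp add: q.emeasure_space_1 top_unique)
  then show False using H(2) by simp
qed

text \<open>For odd degree \<open>\<phi>\<close> is large at \<open>- \<infinity>\<close> and only strategies with a finite moment are
sensible; they integrate the bound \<open>payoff_lower\<close> of the game with the opposite sign. For even
degree \<open>\<phi>\<close> is bounded above and a constant serves as the bound.\<close>

lemma v_flat_negative_polynomial:
  fixes \<alpha> :: "nat \<Rightarrow> real"
  assumes M: "M \<ge> 1" and lead: "\<alpha> M < 0"
  shows "v_flat {0..} {0..} (\<lambda>a b. \<Sum>n=0..M. \<alpha> n * (a - b) ^ n) = - \<infinity>"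
proof -
  let ?\<phi> = "\<lambda>s. \<Sum>n=0..M. \<alpha> n * s ^ n"
  have cont: "continuous_on UNIV ?\<phi>" by (intro continuous_intros)
  have neg: "(\<Sum>n=0..M. - \<alpha> n * s ^ n) = - ?\<phi> s" for s by (simp add: sum_negf)
  have lim: "filterlim (\<lambda>s. - ?\<phi> s) at_top at_top"
    using polynomial_at_top[OF M, of "\<lambda>n. - \<alpha> n"] lead unfolding neg by simp
  have "payoff_flat {0..} (\<lambda>a b. ?\<phi> (a - b)) q = - \<infinity>"
    if q: "q \<in> sensible_II {0..} {0..} (\<lambda>a b. ?\<phi> (a - b))" for q
  proof -
    have qB: "q \<in> borel_probs {0..}" using q by (simp add: sensible_II_def)
    interpret q: prob_space q by (rule borel_probsD[OF qB])
    show ?thesis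
    proof (cases "odd M")
      case True
      obtain k C where "odd_growth (\<lambda>s. \<Sum>n=0..M. - \<alpha> n * s ^ n) M k C"
        using odd_polynomial_growth[OF M True, of "\<lambda>n. - \<alpha> n"] lead by auto
      then interpret neg: odd_growth "\<lambda>s. - ?\<phi> s" M k C by (simp only: neg)
      have "payoff_defined (\<lambda>a b. ?\<phi> (a - b)) q q" using q qB by (simp add: sensible_II_def)
      then have "payoff_defined (\<lambda>a b. - ?\<phi> (a - b)) q q" by (auto simp: payoff_defined_iff_gain)
      then have fin: "neg.moment_finite q" using neg.not_payoff_defined_diagonal[OF qB] by blast
      show ?thesis
      proof (rule payoff_flat_eq_minus_infinity[OF cont lim qB])
        show "?\<phi> (a - b) \<le> C * (1 + b ^ M)" if "a \<ge> 0" "b \<ge> 0" for a b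
          using neg.payoff_lower[OF that] by simp
        have "(\<integral>\<^sup>+ b. ennreal (C * (1 + b ^ M)) \<partial>q) = ennreal (\<integral>b. C * (1 + b ^ M) \<partial>q)"
          using fin neg.C_nonneg borel_probsD(3)[OF qB] unfolding neg.moment_finite_def
          by (intro nn_integral_eq_integral AE_I2) auto
        then show "(\<integral>\<^sup>+ b. ennreal (C * (1 + b ^ M)) \<partial>q) \<noteq> \<infinity>" by simp
      qed
    next
      case False
      have lead1: "- \<alpha> M > 0" and lead2: "- (\<alpha> M * (- 1) ^ M) > 0" using lead False by auto
      obtain k1 C1 where 1: "k1 > 0" "C1 \<ge> 0" "\<And>s. s \<ge> 0 \<Longrightarrow> k1 * s ^ M - C1 \<le> - ?\<phi> s"
          "\<And>s. s \<ge> 0 \<Longrightarrow> - ?\<phi> s \<le> C1 * (1 + s ^ M)"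
        using polynomial_growth[of M "\<lambda>n. - \<alpha> n", OF M lead1, unfolded neg] by blast
      have neg': "(\<Sum>n=0..M. - (\<alpha> n * (- 1) ^ n) * s ^ n) = - ?\<phi> (- s)" for s
        by (simp add: polynomial_minus sum_negf)
      obtain k2 C2 where 2: "k2 > 0" "C2 \<ge> 0" "\<And>s. s \<ge> 0 \<Longrightarrow> k2 * s ^ M - C2 \<le> - ?\<phi> (- s)"
          "\<And>s. s \<ge> 0 \<Longrightarrow> - ?\<phi> (- s) \<le> C2 * (1 + s ^ M)"
        using polynomial_growth[of M "\<lambda>n. - (\<alpha> n * (- 1) ^ n)", OF M lead2, unfolded neg'] by blast
      have le: "?\<phi> s \<le> max C1 C2" for s
      proof (cases "s \<ge> 0")
        case True
        then have "0 \<le> k1 * s ^ M" using 1(1) by simp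
        then show ?thesis using 1(3)[OF True] by simp
      next
        case False
        then have "0 \<le> k2 * (- s) ^ M" using 2(1) by simp
        then show ?thesis using 2(3)[of "- s"] False by simp
      qed
      show ?thesis
        by (rule payoff_flat_eq_minus_infinity[OF cont lim qB, of "\<lambda>_. max C1 C2"])
           (use le in \<open>auto simp: q.emeasure_space_1\<close>)
    qed
  qed
  then have "v_flat {0..} {0..} (\<lambda>a b. ?\<phi> (a - b)) \<le> - \<infinity>"
    unfolding v_flat_def by (intro SUP_least) simp
  then show ?thesis by simp
qed

lemma v_sharp_even_polynomial:
  fixes \<alpha> :: "nat \<Rightarrow> real"
  assumes M: "M \<ge> 1" and even: "even M" and lead: "\<alpha> M > 0"
  shows "v_sharp {0..} {0..} (\<lambda>a b. \<Sum>n=0..M. \<alpha> n * (a - b) ^ n) = \<infinity>"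
proof -
  define \<psi> where "\<psi> s = (\<Sum>n=0..M. - (\<alpha> n * (- 1) ^ n) * s ^ n)" for s
  have cont: "continuous_on UNIV \<psi>" unfolding \<psi>_def by (intro continuous_intros)
  have "v_flat {0..} {0..} (\<lambda>b a. \<psi> (b - a)) = - \<infinity>"
    unfolding \<psi>_def by (rule v_flat_negative_polynomial) (use M even lead in auto)
  moreover have "- \<psi> (b - a) = (\<Sum>n=0..M. \<alpha> n * (a - b) ^ n)" for a b
    using polynomial_minus[of \<alpha> "b - a" M] by (simp add: \<psi>_def sum_negf)
  ultimately show ?thesis
    using measurable_game.v_sharp_reversed[OF measurable_game_difference[OF cont]] by simp
qed

lemma not_bdd_below_if_minus_at_top:
  fixes f :: "real \<Rightarrow> real"
  assumes "filterlim (\<lambda>s. - f s) at_top at_top"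
  shows "\<not> bdd_below (f ` {0..})"
proof
  assume "bdd_below (f ` {0..})"
  then obtain K where K: "\<And>s. s \<ge> 0 \<Longrightarrow> K \<le> f s" by (auto simp: bdd_below_def)
  have "\<forall>\<^sub>F s in at_top. - K < - f s"
    using assms unfolding filterlim_at_top_dense by blast
  then have "\<forall>\<^sub>F s in at_top. - K < - f s \<and> 0 \<le> s"
    using eventually_ge_at_top by (rule eventually_conj)
  then obtain s where "- K < - f s" "0 \<le> s" using eventually_happens'[OF trivial_limit_at_top_linorder] by blast
  then show False using K[of s] by simp
qed

section \<open>Polynomial payoffs\<close>

theorem proposition4p4:
  fixes M :: nat and \<alpha> :: "nat \<Rightarrow> real" and \<phi> :: "real \<Rightarrow> real"
    and A B :: "real set" and c :: "real \<Rightarrow> real \<Rightarrow> real"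
  assumes M: "M \<ge> 1"
    and lead: "\<alpha> M \<noteq> 0"
    and \<phi>: "\<phi> = (\<lambda>s. \<Sum>n=0..M. \<alpha> n * s ^ n)"
    and A: "A = {0..}" and B: "B = {0..}"
    and c: "c = (\<lambda>a b. \<phi> (a - b))"
  shows "(odd M \<and> \<alpha> M > 0 \<longrightarrow>
      zero_sum_game A B c
    \<and> (\<forall>b\<in>B. lsc_on A (\<lambda>a. ereal (c a b)))
    \<and> (\<exists>b\<^sub>0\<in>B. inf_compact_on A (\<lambda>a. ereal (c a b\<^sub>0)))
    \<and> (\<forall>a\<in>A. usc_on B (\<lambda>b. ereal (c a b)))
    \<and> (\<exists>a\<^sub>0\<in>A. sup_compact_on B (\<lambda>b. ereal (c a\<^sub>0 b)))
    \<and> (\<forall>p \<in> borel_probs A - sensible_I A B c. payoff_sharp B c p > v_sharp A B c)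
    \<and> (\<forall>q \<in> borel_probs B - sensible_II A B c. payoff_flat A c q < v_flat A B c)
    \<and> (\<exists>v::real. is_game_value A B c (ereal v)
        \<and> (\<exists>p \<in> P_sharp A B c (ereal v). \<exists>q \<in> P_flat A B c (ereal v). is_solution A B c p q)
        \<and> P_sharp A B c (ereal v) \<noteq> {}
        \<and> convex_measures (P_sharp A B c (ereal v))
        \<and> compactin (weak_topology A) (P_sharp A B c (ereal v))
        \<and> P_sharp A B c (ereal v) \<subseteq> sensible_I A B c
        \<and> P_flat A B c (ereal v) \<noteq> {}
        \<and> convex_measures (P_flat A B c (ereal v))
        \<and> compactin (weak_topology B) (P_flat A B c (ereal v))
        \<and> P_flat A B c (ereal v) \<subseteq> sensible_II A B c
        \<and> (\<forall>p \<in> sensible_I A B c. \<forall>q \<in> sensible_II A B c.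
             is_solution A B c p q \<longleftrightarrow>
               p \<in> P_sharp A B c (ereal v) \<and> q \<in> P_flat A B c (ereal v)))
    \<and> (M \<ge> 3 \<and> \<alpha> 1 < 0 \<longrightarrow> \<not> (\<exists>p q. is_pure_solution A B c p q)))
  \<and> (even M \<or> \<alpha> M < 0 \<longrightarrow>
      (\<not> bounded_below_I A B c \<or> \<not> bounded_above_II A B c)
    \<and> (\<bar>v_flat A B c\<bar> = \<infinity> \<or> \<bar>v_sharp A B c\<bar> = \<infinity>)
    \<and> \<not> (\<exists>v::real. is_game_value A B c (ereal v)))"
    (is "(_ \<longrightarrow> ?odd_positive) \<and> (_ \<longrightarrow> ?bounds \<and> ?infinite \<and> ?no_value)")
proof (intro conjI[of "_ \<longrightarrow> _"] impI)
  assume oddpos: "odd M \<and> \<alpha> M > 0"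
  obtain k C where "odd_growth \<phi> M k C"
    unfolding \<phi> using odd_polynomial_growth[of M \<alpha>] M oddpos by auto
  then interpret odd_growth \<phi> M k C .
  interpret reversed: odd_growth "\<lambda>s. - \<phi> (- s)" M k C by (rule odd_growth_reversed)
  obtain v where vs: "v_sharp {0..} {0..} c = ereal v" unfolding c by (rule v_sharp_real)
  have vf: "v_flat {0..} {0..} c = ereal v" using v_flat_eq_v_sharp vs unfolding c by blast
  note Ps = P_sharp_nonempty[OF vs[unfolded c], folded c] convex_measures_P_sharp[of v, folded c]
    compactin_P_sharp[of v, folded c] P_sharp_sensible[of v, folded c]
  note Pf = convex_compact_nonempty_P_flat[OF vs[unfolded c], folded c] P_flat_sensible[of v, folded c]
  note iff = solution_iff_optimal[folded c, OF vf vs]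
  have usc: "usc_on {0..} (\<lambda>b. ereal (c a b))" for a
    using reversed.lsc_payoff[of a] by (simp add: usc_on_def c)
  have sup: "sup_compact_on {0..} (\<lambda>b. ereal (c 0 b))"
    using reversed.inf_compact_payoff by (simp add: sup_compact_on_def c)
  have unsharp: "payoff_sharp {0..} c p > v_sharp {0..} {0..} c"
    if "p \<in> borel_probs {0..} - sensible_I {0..} {0..} c" for p
    using that payoff_sharp_not_sensible[folded c] vs by simp
  have unflat: "payoff_flat {0..} c q < v_flat {0..} {0..} c"
    if "q \<in> borel_probs {0..} - sensible_II {0..} {0..} c" for q
    using that payoff_flat_not_sensible[folded c] vf by simp
  have solution: "\<exists>p \<in> P_sharp {0..} {0..} c (ereal v). \<exists>q \<in> P_flat {0..} {0..} c (ereal v).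
      is_solution {0..} {0..} c p q"
    using Ps(1,4) Pf(1,4) iff by blast
  have pure: "\<not> is_pure_solution {0..} {0..} c p q" if "\<alpha> 1 < 0" for p q
    unfolding c
  proof (rule no_pure_solution)
    show "\<exists>s\<in>{x..y}. \<phi> s \<noteq> K" if "x < y" for x y K
      unfolding \<phi> by (rule polynomial_nonconstant_on_interval[of M \<alpha>, OF M lead that])
    show "(\<phi> has_real_derivative \<alpha> 1) (at 0)"
      unfolding \<phi> by (rule polynomial_derivative_at_0[OF M])
  qed (rule that)
  show ?odd_positive
    unfolding A B
  proof (intro conjI exI[of _ v])
    show "\<exists>b\<^sub>0\<in>{0..}. inf_compact_on {0..} (\<lambda>a. ereal (c a b\<^sub>0))"
      using inf_compact_payoff by (intro bexI[of _ 0]) (auto simp: c)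
    show "\<exists>a\<^sub>0\<in>{0..}. sup_compact_on {0..} (\<lambda>b. ereal (c a\<^sub>0 b))"
      using sup by (intro bexI[of _ 0]) auto
    show "is_game_value {0..} {0..} c (ereal v)" using vf vs by (simp add: is_game_value_def)
    show "\<forall>b\<in>{0..}. lsc_on {0..} (\<lambda>a. ereal (c a b))" using lsc_payoff by (simp add: c)
    show "zero_sum_game {0..} {0..} c" unfolding c by (rule zero_sum_game_difference)
  qed (use usc unsharp unflat solution Ps Pf iff pure in blast)+
next
  assume unbounded: "even M \<or> \<alpha> M < 0"
  have "\<alpha> M < 0 \<or> even M \<and> \<alpha> M > 0" using unbounded lead by linarith
  then have main: "?bounds \<and> ?infinite"
  proof
    assume neg: "\<alpha> M < 0"
    have "filterlim (\<lambda>s. - \<phi> s) at_top at_top"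
      using polynomial_at_top[OF M, of "\<lambda>n. - \<alpha> n"] neg by (simp add: \<phi> sum_negf)
    then have "\<not> bdd_below (\<phi> ` {0..})" by (rule not_bdd_below_if_minus_at_top)
    then have "\<not> bounded_below_I A B c"
      unfolding bounded_below_I_def by (auto simp: A B c intro!: bexI[of _ 0])
    moreover have "v_flat A B c = - \<infinity>"
      unfolding A B c \<phi> by (rule v_flat_negative_polynomial[of M \<alpha>, OF M neg])
    ultimately show ?thesis by simp
  next
    assume pos: "even M \<and> \<alpha> M > 0"
    have "filterlim (\<lambda>s. - (- \<phi> (- s))) at_top at_top"
      using polynomial_at_top[OF M, of "\<lambda>n. \<alpha> n * (- 1) ^ n"] pos by (simp add: \<phi> polynomial_minus)
    then have "\<not> bdd_below ((\<lambda>s. - \<phi> (- s)) ` {0..})" by (rule not_bdd_below_if_minus_at_top)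
    then have "\<not> bdd_above ((\<lambda>s. \<phi> (- s)) ` {0..})"
      by (auto simp: bdd_below_def bdd_above_def) (metis neg_le_iff_le)
    then have "\<not> bounded_above_II A B c"
      unfolding bounded_above_II_def by (auto simp: A B c intro!: bexI[of _ 0])
    moreover have "v_sharp A B c = \<infinity>"
      unfolding A B c \<phi> using v_sharp_even_polynomial[of M \<alpha>] M pos by simp
    ultimately show ?thesis by simp
  qed
  then have ?no_value by (auto simp: is_game_value_def)
  with main show "?bounds \<and> ?infinite \<and> ?no_value" by (intro conjI) (elim conjE, assumption)+
qed

end
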